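(* Let $\mathbb{G}$ be a graded Lie group of homogeneous dimension $Q$, let $\mathcal{R}$ be a positive Rockland operator on $\mathbb{G}$, and let $T>0$. Let $V$ be a real coefficient with $V\in C_0(\mathbb{G})$, let $(V_\epsilon)_\epsilon$ be a regularisation of $V$, let $u_0\in L^2(\mathbb{G})$, and let $(u_{0,\epsilon})_\epsilon$ be the regularisation of $u_0$. Let $(u_\epsilon)_\epsilon$ be the net of solutions to $$\partial_tu_\epsilon+\mathcal{R}u_\epsilon+V_\epsilon u_\epsilon=0\ \text{on }[0,T]\times\mathbb{G},\qquad u_\epsilon(0,\cdot)=u_{0,\epsilon}.$$ Then, as $\epsilon\to0$, $u_\epsilon$ converges in $L^2(\mathbb{G})$ (that is, $\|u_\epsilon(t,\cdot)-u(t,\cdot)\|_{L^2(\mathbb{G})}\to0$ for $t\in[0,T]$) to the classical solution $u$, i.e. the unique solution $u\in C([0,T];L^2(\mathbb{G}))$ of $$u_t+\mathcal{R}u+Vu=0\ \text{on }[0,T]\times\mathbb{G},\qquad u(0,\cdot)=u_0.$$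
   Context: A graded Lie group $\mathbb{G}$ is a connected simply connected Lie group whose Lie algebra decomposes as $\mathfrak{g}=\bigoplus_{i\ge1}\mathfrak{g}_i$ (all but finitely many $\mathfrak{g}_i$ zero) with $[\mathfrak{g}_i,\mathfrak{g}_j]\subset\mathfrak{g}_{i+j}$. It carries the canonical dilations $D_r(x)=(r^{\nu_1}x_1,\dots,r^{\nu_n}x_n)$, $r>0$, and its homogeneous dimension is $Q=\nu_1+\cdots+\nu_n$. A Rockland operator $\mathcal{R}$ is a left-invariant differential operator on $\mathbb{G}$, homogeneous of positive degree with respect to the dilations, such that for every nontrivial irreducible unitary representation $\pi$ of $\mathbb{G}$ the operator $\pi(\mathcal{R})$ is injective on the smooth vectors; it is positive if it is non-negative on $\mathcal{D}(\mathbb{G})\subset L^2(\mathbb{G})$, and $\mathcal{R}$ also denotes its self-adjoint extension on $L^2(\mathbb{G})$. Regularisations: a Friedrichs mollifier is a compactly supported smooth $\psi$ with $\int_{\mathbb{G}}\psi\,dx=1$; one sets $\psi_\epsilon(x)=\omega(\epsilon)^{-Q}\psi(D_{\omega(\epsilon)^{-1}}(x))$, $\epsilon\in(0,1]$, where $\omega(\epsilon)>0$ converges to $0$ as $\epsilon\to0$; the regularisation of $v$ is $v_\epsilon=v*\psi_\epsilon$. $C_0(\mathbb{G})$ is the space of continuous functions on $\mathbb{G}$ vanishing at infinity: for every $\delta>0$ there is a compact set $K_\delta$ with $|f|<\delta$ on $\mathbb{G}\setminus K_\delta$. For real $V\in L^\infty(\mathbb{G})$ and $u_0\in L^2(\mathbb{G})$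 the paper's well-posedness proposition asserts the existence and uniqueness of the classical solution in $C([0,T];L^2(\mathbb{G}))$. *)

theory Defs
  imports "HOL-Analysis.Analysis"
begin

section \<open>Smooth functions\<close>

primrec C_k :: "nat \<Rightarrow> ('a::real_normed_vector \<Rightarrow> 'b::real_normed_vector) \<Rightarrow> bool" where
  "C_k 0 f \<longleftrightarrow> continuous_on UNIV f"
| "C_k (Suc k) f \<longleftrightarrow>
     (\<forall>x. f differentiable (at x)) \<and> (\<forall>v. C_k k (\<lambda>x. frechet_derivative f (at x) v))"

definition smooth :: "('a::real_normed_vector \<Rightarrow> 'b::real_normed_vector) \<Rightarrow> bool" where
  "smooth f \<longleftrightarrow> (\<forall>k. C_k k f)"

definition test_functions :: "(real ^ 'n \<Rightarrow> complex) set" where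
  "test_functions = {\<phi>. smooth \<phi> \<and> compact (closure {x. \<phi> x \<noteq> 0})}"


section \<open>Graded Lie groups\<close>

text \<open>
  A graded Lie group is nilpotent, connected and simply connected, so its exponential map is a
  global diffeomorphism. We write the group in exponential coordinates with respect to a basis
  of the Lie algebra adapted to the grading: the underlying manifold is \<open>real ^ 'n\<close>, the unit
  is \<open>0\<close>, the exponential map is the identity, i.e. the one-parameter subgroups are the lines
  \<open>t \<mapsto> t *\<^sub>R v\<close>, the inverse of \<open>x\<close> is \<open>- x\<close>, and \<open>\<nu> i\<close> is the degree of the
  \<open>i\<close>-th basis vector. Lebesgue measure \<open>lborel\<close> is then a (bi-invariant) Haar measure; it is
  the measure \<open>dx\<close> used throughout.
\<close>

text \<open>The left-invariant vector field generated by \<open>v\<close>, acting on \<open>f\<close>.\<close>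

definition left_deriv ::
  "(real ^ 'n \<Rightarrow> real ^ 'n \<Rightarrow> real ^ 'n) \<Rightarrow> real ^ 'n \<Rightarrow> (real ^ 'n \<Rightarrow> 'b::real_normed_vector)
     \<Rightarrow> real ^ 'n \<Rightarrow> 'b" where
  "left_deriv gmul v f x = vector_derivative (\<lambda>t. f (gmul x (t *\<^sub>R v))) (at 0)"

text \<open>
  The Lie bracket of the group, on its tangent space at the unit: the value at \<open>0\<close> of the
  commutator of the two left-invariant vector fields, read off by applying it to the
  coordinate functions.
\<close>

definition lie_bracket ::
  "(real ^ 'n \<Rightarrow> real ^ 'n \<Rightarrow> real ^ 'n) \<Rightarrow> real ^ 'n \<Rightarrow> real ^ 'n \<Rightarrow> real ^ 'n" where
  "lie_bracket gmul v w =
     left_deriv gmul v (left_deriv gmul w (\<lambda>x. x)) 0 - left_deriv gmul w (left_deriv gmul v (\<lambda>x. x)) 0"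

definition layer :: "('n \<Rightarrow> nat) \<Rightarrow> nat \<Rightarrow> (real ^ 'n) set" where
  "layer \<nu> k = {v. \<forall>i. \<nu> i \<noteq> k \<longrightarrow> v $ i = 0}"

definition graded_lie_group ::
  "(real ^ 'n \<Rightarrow> real ^ 'n \<Rightarrow> real ^ 'n) \<Rightarrow> ('n \<Rightarrow> nat) \<Rightarrow> bool" where
  "graded_lie_group gmul \<nu> \<longleftrightarrow>
     (\<forall>x y z. gmul (gmul x y) z = gmul x (gmul y z)) \<and>
     (\<forall>x. gmul 0 x = x \<and> gmul x 0 = x) \<and>
     (\<forall>x s t. gmul (s *\<^sub>R x) (t *\<^sub>R x) = (s + t) *\<^sub>R x) \<and>
     smooth (\<lambda>(x, y). gmul x y) \<and>
     (\<forall>i. 1 \<le> \<nu> i) \<and>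
     (\<forall>k l. \<forall>v\<in>layer \<nu> k. \<forall>w\<in>layer \<nu> l. lie_bracket gmul v w \<in> layer \<nu> (k + l))"

definition dilation :: "('n \<Rightarrow> nat) \<Rightarrow> real \<Rightarrow> real ^ 'n \<Rightarrow> real ^ 'n" where
  "dilation \<nu> r x = (\<chi> i. r ^ \<nu> i * x $ i)"

definition homogeneous_dim :: "('n::finite \<Rightarrow> nat) \<Rightarrow> nat" where
  "homogeneous_dim \<nu> = (\<Sum>i\<in>UNIV. \<nu> i)"


section \<open>Left-invariant differential operators\<close>

definition partial_deriv :: "'n \<Rightarrow> (real ^ 'n \<Rightarrow> complex) \<Rightarrow> real ^ 'n \<Rightarrow> complex" where
  "partial_deriv i f x = frechet_derivative f (at x) (axis i 1)"

text \<open>A list of indices stands for the corresponding iterated derivative.\<close>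

definition differential_operator ::
  "((real ^ 'n \<Rightarrow> complex) \<Rightarrow> real ^ 'n \<Rightarrow> complex) \<Rightarrow> bool" where
  "differential_operator R \<longleftrightarrow>
     (\<exists>(S :: 'n list set) a. finite S \<and> (\<forall>\<alpha>\<in>S. smooth (a \<alpha>)) \<and>
        (\<forall>f. smooth f \<longrightarrow> (\<forall>x. R f x = (\<Sum>\<alpha>\<in>S. a \<alpha> x * foldr partial_deriv \<alpha> f x))))"

definition left_invariant ::
  "(real ^ 'n \<Rightarrow> real ^ 'n \<Rightarrow> real ^ 'n) \<Rightarrow> ((real ^ 'n \<Rightarrow> complex) \<Rightarrow> real ^ 'n \<Rightarrow> complex) \<Rightarrow> bool" where
  "left_invariant gmul R \<longleftrightarrow>
     (\<forall>y f x. smooth f \<longrightarrow> R (\<lambda>z. f (gmul y z)) x = R f (gmul y x))"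

definition homogeneous_of_degree ::
  "('n::finite \<Rightarrow> nat) \<Rightarrow> real \<Rightarrow> ((real ^ 'n \<Rightarrow> complex) \<Rightarrow> real ^ 'n \<Rightarrow> complex) \<Rightarrow> bool" where
  "homogeneous_of_degree \<nu> d R \<longleftrightarrow>
     (\<forall>r>0. \<forall>f x. smooth f \<longrightarrow>
        R (\<lambda>z. f (dilation \<nu> r z)) x = complex_of_real (r powr d) * R f (dilation \<nu> r x))"

text \<open>
  The finitely supported family \<open>c\<close> stands for the element
  \<open>\<Sum> c [i\<^sub>1, \<dots>, i\<^sub>k] X\<^bsub>i\<^sub>1\<^esub> \<cdots> X\<^bsub>i\<^sub>k\<^esub>\<close> of the (complexified) universal enveloping algebra,
  \<open>X\<^sub>i\<close> being the \<open>i\<close>-th basis vector of the Lie algebra. The predicate says that \<open>R\<close> is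
  the left-invariant differential operator given by this element.
\<close>

definition enveloping_element_of ::
  "(real ^ 'n \<Rightarrow> real ^ 'n \<Rightarrow> real ^ 'n) \<Rightarrow> ((real ^ 'n \<Rightarrow> complex) \<Rightarrow> real ^ 'n \<Rightarrow> complex)
     \<Rightarrow> ('n list \<Rightarrow> complex) \<Rightarrow> bool" where
  "enveloping_element_of gmul R c \<longleftrightarrow>
     finite {\<alpha>. c \<alpha> \<noteq> 0} \<and>
     (\<forall>f. smooth f \<longrightarrow> (\<forall>x. R f x =
        (\<Sum>\<alpha> | c \<alpha> \<noteq> 0. c \<alpha> * foldr (\<lambda>i. left_deriv gmul (axis i 1)) \<alpha> f x)))"


section \<open>The Hilbert space of square-summable sequences\<close>

typedef ell2 = "{x :: nat \<Rightarrow> complex. summable (\<lambda>k. (cmod (x k))\<^sup>2)}"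
  morphisms coord Abs_ell2
  by (rule exI[of _ "\<lambda>_. 0"]) simp

lemma coord_summable: "summable (\<lambda>k. (cmod (coord x k))\<^sup>2)"
  using coord[of x] by simp

lemma ell2_eqI: "(\<And>k. coord x k = coord y k) \<Longrightarrow> x = y"
  by (meson coord_inject ext)

lemma summable_add_sq:
  fixes f g :: "nat \<Rightarrow> complex"
  assumes "summable (\<lambda>k. (cmod (f k))\<^sup>2)" "summable (\<lambda>k. (cmod (g k))\<^sup>2)"
  shows "summable (\<lambda>k. (cmod (f k + g k))\<^sup>2)"
proof (rule summable_comparison_test')
  show "summable (\<lambda>k. 2 * (cmod (f k))\<^sup>2 + 2 * (cmod (g k))\<^sup>2)"
    using assms by (intro summable_add summable_mult)
  fix k :: nat
  have "(cmod (f k + g k))\<^sup>2 \<le> (cmod (f k) + cmod (g k))\<^sup>2"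
    by (intro power_mono norm_triangle_ineq) auto
  also have "\<dots> \<le> 2 * (cmod (f k))\<^sup>2 + 2 * (cmod (g k))\<^sup>2"
    using zero_le_power2[of "cmod (f k) - cmod (g k)"]
    by (simp add: power2_eq_square algebra_simps)
  finally show "norm ((cmod (f k + g k))\<^sup>2) \<le> 2 * (cmod (f k))\<^sup>2 + 2 * (cmod (g k))\<^sup>2"
    by simp
qed

lemma summable_scale_sq:
  fixes f :: "nat \<Rightarrow> complex"
  assumes "summable (\<lambda>k. (cmod (f k))\<^sup>2)"
  shows "summable (\<lambda>k. (cmod (a * f k))\<^sup>2)"
  using summable_mult[OF assms, of "(cmod a)\<^sup>2"] by (simp add: norm_mult power_mult_distrib)

lemma summable_coord_inner: "summable (\<lambda>k. coord x k \<bullet> coord y k)"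
proof (rule summable_comparison_test')
  show "summable (\<lambda>k. (cmod (coord x k))\<^sup>2 + (cmod (coord y k))\<^sup>2)"
    by (intro summable_add coord_summable)
  fix k :: nat
  have "\<bar>coord x k \<bullet> coord y k\<bar> \<le> cmod (coord x k) * cmod (coord y k)"
    by (rule Cauchy_Schwarz_ineq2)
  also have "\<dots> \<le> (cmod (coord x k))\<^sup>2 + (cmod (coord y k))\<^sup>2"
    using sum_squares_bound[of "cmod (coord x k)" "cmod (coord y k)"]
      mult_nonneg_nonneg[OF norm_ge_zero norm_ge_zero, of "coord x k" "coord y k"]
    by linarith
  finally show "norm (coord x k \<bullet> coord y k) \<le> (cmod (coord x k))\<^sup>2 + (cmod (coord y k))\<^sup>2"
    by simp
qed

definition scaleC_ell2 :: "complex \<Rightarrow> ell2 \<Rightarrow> ell2" where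
  "scaleC_ell2 a x = Abs_ell2 (\<lambda>k. a * coord x k)"

instantiation ell2 :: real_inner
begin

definition zero_ell2 :: ell2 where "zero_ell2 = Abs_ell2 (\<lambda>_. 0)"
definition plus_ell2 :: "ell2 \<Rightarrow> ell2 \<Rightarrow> ell2" where
  "plus_ell2 x y = Abs_ell2 (\<lambda>k. coord x k + coord y k)"
definition uminus_ell2 :: "ell2 \<Rightarrow> ell2" where
  "uminus_ell2 x = scaleC_ell2 (-1) x"
definition minus_ell2 :: "ell2 \<Rightarrow> ell2 \<Rightarrow> ell2" where
  "minus_ell2 x y = x + - (y :: ell2)"
definition scaleR_ell2 :: "real \<Rightarrow> ell2 \<Rightarrow> ell2" where
  "scaleR_ell2 r x = scaleC_ell2 (complex_of_real r) x"

text \<open>The real part of the complex inner product.\<close>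

definition inner_ell2 :: "ell2 \<Rightarrow> ell2 \<Rightarrow> real" where
  "inner_ell2 x y = (\<Sum>k. coord x k \<bullet> coord y k)"
definition norm_ell2 :: "ell2 \<Rightarrow> real" where
  "norm_ell2 x = sqrt (x \<bullet> x)"
definition sgn_ell2 :: "ell2 \<Rightarrow> ell2" where
  "sgn_ell2 x = inverse (norm x) *\<^sub>R x"
definition dist_ell2 :: "ell2 \<Rightarrow> ell2 \<Rightarrow> real" where
  "dist_ell2 x y = norm (x - y)"
definition uniformity_ell2 :: "(ell2 \<times> ell2) filter" where
  "uniformity_ell2 = (INF e\<in>{0<..}. principal {(x, y). dist x y < e})"
definition open_ell2 :: "ell2 set \<Rightarrow> bool" where
  "open_ell2 U \<longleftrightarrow> (\<forall>x\<in>U. eventually (\<lambda>(x', y). x' = x \<longrightarrow> y \<in> U) uniformity)"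

lemma coord_scaleC: "coord (scaleC_ell2 a x) = (\<lambda>k. a * coord x k)"
  unfolding scaleC_ell2_def using summable_scale_sq[OF coord_summable]
  by (simp add: Abs_ell2_inverse)

lemma coord_zero: "coord 0 = (\<lambda>_. 0)"
  unfolding zero_ell2_def by (simp add: Abs_ell2_inverse)

lemma coord_plus: "coord (x + y) = (\<lambda>k. coord x k + coord y k)"
  unfolding plus_ell2_def using summable_add_sq[OF coord_summable coord_summable]
  by (simp add: Abs_ell2_inverse)

lemma coord_uminus: "coord (- x) = (\<lambda>k. - coord x k)"
  unfolding uminus_ell2_def by (simp add: coord_scaleC)

lemma coord_minus: "coord (x - y) = (\<lambda>k. coord x k - coord y k)"
  unfolding minus_ell2_def by (simp add: coord_plus coord_uminus)

lemma coord_scaleR: "coord (r *\<^sub>R x) = (\<lambda>k. complex_of_real r * coord x k)"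
  unfolding scaleR_ell2_def by (simp add: coord_scaleC)

instance
proof
  fix x y z :: ell2 and a b r :: real and U :: "ell2 set"
  note cs = coord_zero coord_plus coord_uminus coord_minus coord_scaleR
  show "a *\<^sub>R (x + y) = a *\<^sub>R x + a *\<^sub>R y" "(a + b) *\<^sub>R x = a *\<^sub>R x + b *\<^sub>R x"
    "a *\<^sub>R b *\<^sub>R x = (a * b) *\<^sub>R x" "1 *\<^sub>R x = x"
    "x + y + z = x + (y + z)" "x + y = y + x" "0 + x = x" "- x + x = 0" "x - y = x + - y"
    by (rule ell2_eqI; simp add: cs algebra_simps)+
  show "sgn x = inverse (norm x) *\<^sub>R x" "dist x y = norm (x - y)" "norm x = sqrt (x \<bullet> x)"
    by (simp_all add: sgn_ell2_def dist_ell2_def norm_ell2_def)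
  show "uniformity = (INF e\<in>{0<..}. principal {(x, y). dist x (y :: ell2) < e})"
    by (rule uniformity_ell2_def)
  show "open U \<longleftrightarrow> (\<forall>x\<in>U. eventually (\<lambda>(x', y). x' = x \<longrightarrow> y \<in> U) uniformity)"
    by (rule open_ell2_def)
  show "x \<bullet> y = y \<bullet> x"
    by (simp add: inner_ell2_def inner_commute)
  show "(x + y) \<bullet> z = x \<bullet> z + y \<bullet> z"
    by (simp add: inner_ell2_def coord_plus inner_add_left suminf_add summable_coord_inner)
  have "(\<lambda>k. coord (r *\<^sub>R x) k \<bullet> coord y k) = (\<lambda>k. r * (coord x k \<bullet> coord y k))"
    by (rule ext) (simp add: coord_scaleR flip: scaleR_conv_of_real)
  then show "r *\<^sub>R x \<bullet> y = r * (x \<bullet> y)"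
    by (simp add: inner_ell2_def suminf_mult summable_coord_inner)
  show "0 \<le> x \<bullet> x"
    unfolding inner_ell2_def by (intro suminf_nonneg summable_coord_inner) simp
  have "x \<bullet> x = 0 \<longleftrightarrow> (\<forall>k. coord x k = 0)"
    unfolding inner_ell2_def
    by (subst suminf_eq_zero_iff) (simp_all add: summable_coord_inner)
  then show "x \<bullet> x = 0 \<longleftrightarrow> x = 0"
    by (auto simp: coord_zero intro: ell2_eqI)
qed

end


section \<open>Unitary representations and Rockland operators\<close>

text \<open>
  Representation spaces are closed complex subspaces of \<open>ell2\<close>. Up to unitary equivalence these
  are all separable Hilbert spaces, and an irreducible unitary representation of a second
  countable group acts on a separable space (the closed span of one orbit).
\<close>

definition closed_csubspace :: "ell2 set \<Rightarrow> bool" where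
  "closed_csubspace H \<longleftrightarrow> closed H \<and> 0 \<in> H \<and>
     (\<forall>v\<in>H. \<forall>w\<in>H. v + w \<in> H) \<and> (\<forall>a. \<forall>v\<in>H. scaleC_ell2 a v \<in> H)"

definition unitary_rep ::
  "(real ^ 'n \<Rightarrow> real ^ 'n \<Rightarrow> real ^ 'n) \<Rightarrow> ell2 set \<Rightarrow> (real ^ 'n \<Rightarrow> ell2 \<Rightarrow> ell2) \<Rightarrow> bool" where
  "unitary_rep gmul H \<pi> \<longleftrightarrow> closed_csubspace H \<and>
     (\<forall>x. \<pi> x ` H = H \<and>
        (\<forall>v\<in>H. \<forall>w\<in>H. \<pi> x (v + w) = \<pi> x v + \<pi> x w) \<and>
        (\<forall>a. \<forall>v\<in>H. \<pi> x (scaleC_ell2 a v) = scaleC_ell2 a (\<pi> x v)) \<and>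
        (\<forall>v\<in>H. norm (\<pi> x v) = norm v)) \<and>
     (\<forall>v\<in>H. \<pi> 0 v = v) \<and>
     (\<forall>x y. \<forall>v\<in>H. \<pi> (gmul x y) v = \<pi> x (\<pi> y v)) \<and>
     (\<forall>v\<in>H. continuous_on UNIV (\<lambda>x. \<pi> x v))"

definition irreducible_rep :: "ell2 set \<Rightarrow> (real ^ 'n \<Rightarrow> ell2 \<Rightarrow> ell2) \<Rightarrow> bool" where
  "irreducible_rep H \<pi> \<longleftrightarrow> H \<noteq> {0} \<and>
     (\<forall>K. closed_csubspace K \<and> K \<subseteq> H \<and> (\<forall>x. \<pi> x ` K \<subseteq> K) \<longrightarrow> K = {0} \<or> K = H)"

definition nontrivial_rep :: "ell2 set \<Rightarrow> (real ^ 'n \<Rightarrow> ell2 \<Rightarrow> ell2) \<Rightarrow> bool" where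
  "nontrivial_rep H \<pi> \<longleftrightarrow> (\<exists>x. \<exists>v\<in>H. \<pi> x v \<noteq> v)"

definition smooth_vectors :: "ell2 set \<Rightarrow> (real ^ 'n \<Rightarrow> ell2 \<Rightarrow> ell2) \<Rightarrow> ell2 set" where
  "smooth_vectors H \<pi> = {v \<in> H. smooth (\<lambda>x. \<pi> x v)}"

text \<open>
  The infinitesimal representation: first of the \<open>i\<close>-th basis vector of the Lie algebra, then of
  the element of the universal enveloping algebra given by \<open>c\<close>.
\<close>

definition infinitesimal_rep :: "(real ^ 'n \<Rightarrow> ell2 \<Rightarrow> ell2) \<Rightarrow> 'n \<Rightarrow> ell2 \<Rightarrow> ell2" where
  "infinitesimal_rep \<pi> i v = vector_derivative (\<lambda>t. \<pi> (t *\<^sub>R axis i 1) v) (at 0)"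

definition rep_of_element ::
  "(real ^ 'n \<Rightarrow> ell2 \<Rightarrow> ell2) \<Rightarrow> ('n list \<Rightarrow> complex) \<Rightarrow> ell2 \<Rightarrow> ell2" where
  "rep_of_element \<pi> c v =
     (\<Sum>\<alpha> | c \<alpha> \<noteq> 0. scaleC_ell2 (c \<alpha>) (foldr (infinitesimal_rep \<pi>) \<alpha> v))"

text \<open>
  Every left-invariant differential operator comes from an element of the universal enveloping
  algebra, and \<open>\<pi>(R)\<close> is the image of that element; different \<open>c\<close> for the same \<open>R\<close>
  give the same \<open>\<pi>(R)\<close> on the smooth vectors.
\<close>

definition rockland_operator ::
  "(real ^ 'n \<Rightarrow> real ^ 'n \<Rightarrow> real ^ 'n) \<Rightarrow> ('n \<Rightarrow> nat)
     \<Rightarrow> ((real ^ 'n \<Rightarrow> complex) \<Rightarrow> real ^ 'n \<Rightarrow> complex) \<Rightarrow> bool" where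
  "rockland_operator gmul \<nu> R \<longleftrightarrow>
     differential_operator R \<and> left_invariant gmul R \<and>
     (\<exists>d>0. homogeneous_of_degree \<nu> d R) \<and>
     (\<exists>c. enveloping_element_of gmul R c \<and>
        (\<forall>H \<pi>. unitary_rep gmul H \<pi> \<and> irreducible_rep H \<pi> \<and> nontrivial_rep H \<pi> \<longrightarrow>
           inj_on (rep_of_element \<pi> c) (smooth_vectors H \<pi>)))"


section \<open>Square-integrable functions and operators on them\<close>

definition L2 :: "(real ^ 'n \<Rightarrow> complex) set" where
  "L2 = {f. f \<in> borel_measurable lborel \<and> integrable lborel (\<lambda>x. (cmod (f x))\<^sup>2)}"

definition L2_inner :: "(real ^ 'n \<Rightarrow> complex) \<Rightarrow> (real ^ 'n \<Rightarrow> complex) \<Rightarrow> complex" where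
  "L2_inner f g = (LINT x|lborel. f x * cnj (g x))"

definition L2_norm :: "(real ^ 'n \<Rightarrow> complex) \<Rightarrow> real" where
  "L2_norm f = sqrt (LINT x|lborel. (cmod (f x))\<^sup>2)"

definition positive_operator :: "((real ^ 'n \<Rightarrow> complex) \<Rightarrow> real ^ 'n \<Rightarrow> complex) \<Rightarrow> bool" where
  "positive_operator R \<longleftrightarrow>
     (\<forall>\<phi>\<in>test_functions. L2_inner (R \<phi>) \<phi> \<in> \<real> \<and> 0 \<le> Re (L2_inner (R \<phi>) \<phi>))"

text \<open>
  Unbounded operators on L2 are given by their graphs. As elements of \<open>L2\<close> are functions, not
  classes, the graphs considered are closed under equality almost everywhere in both components.
\<close>

definition L2_adjoint ::
  "((real ^ 'n \<Rightarrow> complex) \<times> (real ^ 'n \<Rightarrow> complex)) set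
     \<Rightarrow> ((real ^ 'n \<Rightarrow> complex) \<times> (real ^ 'n \<Rightarrow> complex)) set" where
  "L2_adjoint A = {(f, g). f \<in> L2 \<and> g \<in> L2 \<and> (\<forall>(p, q)\<in>A. L2_inner q f = L2_inner p g)}"

definition L2_closure ::
  "((real ^ 'n \<Rightarrow> complex) \<times> (real ^ 'n \<Rightarrow> complex)) set
     \<Rightarrow> ((real ^ 'n \<Rightarrow> complex) \<times> (real ^ 'n \<Rightarrow> complex)) set" where
  "L2_closure A = {(f, g). f \<in> L2 \<and> g \<in> L2 \<and>
     (\<exists>p q. (\<forall>k::nat. (p k, q k) \<in> A) \<and>
        (\<lambda>k. L2_norm (\<lambda>x. p k x - f x)) \<longlonglongrightarrow> 0 \<and> (\<lambda>k. L2_norm (\<lambda>x. q k x - g x)) \<longlonglongrightarrow> 0)}"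

text \<open>
  \<open>A\<close> is the self-adjoint extension of \<open>R\<close> from the test functions. A positive Rockland
  operator is essentially self-adjoint there, i.e. it has exactly one self-adjoint extension,
  and this is its closure.
\<close>

definition self_adjoint_extension ::
  "((real ^ 'n \<Rightarrow> complex) \<Rightarrow> real ^ 'n \<Rightarrow> complex)
     \<Rightarrow> ((real ^ 'n \<Rightarrow> complex) \<times> (real ^ 'n \<Rightarrow> complex)) set \<Rightarrow> bool" where
  "self_adjoint_extension R A \<longleftrightarrow>
     L2_adjoint A = A \<and> A = L2_closure {(\<phi>, R \<phi>) | \<phi>. \<phi> \<in> test_functions}"


section \<open>Regularisations\<close>

definition group_convolution ::
  "(real ^ 'n \<Rightarrow> real ^ 'n \<Rightarrow> real ^ 'n) \<Rightarrow> (real ^ 'n \<Rightarrow> complex) \<Rightarrow> (real ^ 'n \<Rightarrow> complex)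
     \<Rightarrow> real ^ 'n \<Rightarrow> complex" where
  "group_convolution gmul f g x = (LINT y|lborel. f y * g (gmul (- y) x))"

text \<open>No sign or reality condition is imposed on a mollifier.\<close>

definition friedrichs_mollifier :: "(real ^ 'n \<Rightarrow> complex) \<Rightarrow> bool" where
  "friedrichs_mollifier \<psi> \<longleftrightarrow> \<psi> \<in> test_functions \<and> (LINT x|lborel. \<psi> x) = 1"

definition rescaled ::
  "('n::finite \<Rightarrow> nat) \<Rightarrow> real \<Rightarrow> (real ^ 'n \<Rightarrow> complex) \<Rightarrow> real ^ 'n \<Rightarrow> complex" where
  "rescaled \<nu> r \<psi> x =
     complex_of_real (inverse r ^ homogeneous_dim \<nu>) * \<psi> (dilation \<nu> (inverse r) x)"

definition regularisation ::
  "(real ^ 'n \<Rightarrow> real ^ 'n \<Rightarrow> real ^ 'n) \<Rightarrow> ('n \<Rightarrow> nat) \<Rightarrow> (real ^ 'n \<Rightarrow> complex)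
     \<Rightarrow> (real \<Rightarrow> real ^ 'n \<Rightarrow> complex) \<Rightarrow> bool" where
  "regularisation gmul \<nu> v v\<epsilon> \<longleftrightarrow>
     (\<exists>\<psi> \<omega>. friedrichs_mollifier \<psi> \<and>
        (\<forall>\<epsilon>\<in>{0<..1}. \<omega> \<epsilon> > 0) \<and> (\<omega> \<longlongrightarrow> 0) (at_right 0) \<and>
        (\<forall>\<epsilon>\<in>{0<..1}. v\<epsilon> \<epsilon> = group_convolution gmul v (rescaled \<nu> (\<omega> \<epsilon>) \<psi>)))"


section \<open>The Cauchy problem\<close>

definition vanishing_at_infinity :: "(real ^ 'n \<Rightarrow> real) \<Rightarrow> bool" where
  "vanishing_at_infinity f \<longleftrightarrow> continuous_on UNIV f \<and>
     (\<forall>\<delta>>0. \<exists>K. compact K \<and> (\<forall>x. x \<notin> K \<longrightarrow> \<bar>f x\<bar> < \<delta>))"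

definition continuous_L2 :: "real \<Rightarrow> (real \<Rightarrow> real ^ 'n \<Rightarrow> complex) \<Rightarrow> bool" where
  "continuous_L2 T u \<longleftrightarrow> (\<forall>t\<in>{0..T}. u t \<in> L2 \<and>
     ((\<lambda>s. L2_norm (\<lambda>x. u s x - u t x)) \<longlongrightarrow> 0) (at t within {0..T}))"

definition has_L2_derivative ::
  "real \<Rightarrow> (real \<Rightarrow> real ^ 'n \<Rightarrow> complex) \<Rightarrow> (real ^ 'n \<Rightarrow> complex) \<Rightarrow> real \<Rightarrow> bool" where
  "has_L2_derivative T u w t \<longleftrightarrow> w \<in> L2 \<and>
     ((\<lambda>s. L2_norm (\<lambda>x. (u s x - u t x) / complex_of_real (s - t) - w x)) \<longlongrightarrow> 0)
       (at t within {0..T})"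

text \<open>
  The equation \<open>\<partial>\<^sub>t u + A u + V u = 0\<close>, \<open>u(0) = u0\<close>, in L2. As \<open>u0\<close> is only in L2, it need
  not lie in the domain of \<open>A\<close>, and \<open>u\<close> need not be differentiable at \<open>0\<close>; hence the
  equation is imposed for \<open>0 < t \<le> T\<close>, the time \<open>0\<close> being covered by the continuity of \<open>u\<close>.
\<close>

definition heat_solution ::
  "((real ^ 'n \<Rightarrow> complex) \<times> (real ^ 'n \<Rightarrow> complex)) set \<Rightarrow> (real ^ 'n \<Rightarrow> complex) \<Rightarrow> real
     \<Rightarrow> (real ^ 'n \<Rightarrow> complex) \<Rightarrow> (real \<Rightarrow> real ^ 'n \<Rightarrow> complex) \<Rightarrow> bool" where
  "heat_solution A V T u0 u \<longleftrightarrow>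
     continuous_L2 T u \<and>
     (AE x in lborel. u 0 x = u0 x) \<and>
     (\<forall>t\<in>{0<..T}. \<exists>w g. has_L2_derivative T u w t \<and> (u t, g) \<in> A \<and>
        (AE x in lborel. w x + g x + V x * u t x = 0))"

end

(*
  Writing d for the difference of two solutions and subtracting the equations, positivity of the
  self-adjoint extension gives D' \<le> (2 M + 1) D + \<delta>\<^sup>2 K for D = |d|\<^sup>2, where M bounds one
  potential, \<delta> is the sup distance of the potentials and K bounds the squared norm of the second
  solution. Gronwall then bounds D by its initial value and \<delta>\<^sup>2 K; this yields uniqueness, and
  convergence once V_\<epsilon> tends to V uniformly and u0_\<epsilon> tends to u0 in L2.

  The latter are approximate-identity statements, which need Lebesgue measure to be invariant under
  left and right translations. Let J(x) be the derivative of left translation by x at the unit.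
  Differentiating (t (x + s v)) (h (x + s v)) = (t + h) (x + s v) in s shows that
  B(t) = t J(t x)^(-1) satisfies J(h x) B(t + h) = J(- h x) B(t) + h; differentiating in h at 0 gives
  B' = 1 - ad_x B. As ad_x strictly raises the degree, J(x)^(-1) is unitriangular with respect to the
  grading, so J(x) and all the derivatives of left translations have determinant one.
*)

theory Submission
  imports Defs
begin

section \<open>Volume-preserving maps\<close>

text \<open>A graded group fixes its law only through the group axioms, smoothness, the lines and
  the bracket at the unit, so neither a polynomial form of the law nor invariance of the measure is
  at hand. No Baker-Campbell-Hausdorff formula is proved: the equation for \<open>B\<close> is
  integrated row by row in order of increasing weight, which is enough for the determinant.
  Convolution averages right translates, so the L2 limit needs right invariance; it follows from
  left invariance because inversion is negation. Mollifiers are complex, hence so is V_\<epsilon>.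
  The energy estimate therefore uses only bounds on moduli of potentials, and the L1 norm of the
  mollifier is the constant in both limits. In the differential inequality 2 M comes from one
  potential and the added 1 from 2 \<delta> |d| |u| \<le> |d|^2 + \<delta>^2 |u|^2. The regularised
  solution is taken as the first one, so that \<open>K\<close> bounds the classical solution and
  does not depend on \<epsilon>.\<close>

lemma det_unitriangular:
  fixes B :: "'a::comm_ring_1 ^ 'n ^ 'n" and w :: "'n \<Rightarrow> nat"
  assumes diag: "\<And>i. B $ i $ i = 1" and off: "\<And>i j. i \<noteq> j \<Longrightarrow> w i \<le> w j \<Longrightarrow> B $ i $ j = 0"
  shows "det B = 1"
proof -
  have 0: "of_int (sign p) * (\<Prod>i\<in>UNIV. B $ i $ p i) = 0"
    if p: "p permutes (UNIV :: 'n set)" "p \<noteq> id" for p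
  proof -
    \<comment> \<open>If every moved index lost weight under \<open>p\<close>, the total weight
      would drop, whereas a permutation preserves it.\<close>
    have "\<exists>i. p i \<noteq> i \<and> w i \<le> w (p i)"
    proof (rule ccontr)
      assume "\<not> ?thesis"
      then have *: "w (p i) < w i \<or> p i = i" for i using not_le by blast
      from p(2) obtain i where "p i \<noteq> i" by (metis eq_id_iff ext)
      then have "(\<Sum>i\<in>UNIV. w (p i)) < (\<Sum>i\<in>UNIV. w i)"
        using * by (intro sum_strict_mono_ex1) (auto intro: less_imp_le, metis order.strict_iff_not order_refl less_imp_le)
      moreover have "(\<Sum>i\<in>UNIV. w (p i)) = (\<Sum>i\<in>UNIV. w i)"
        using sum.permute[OF p(1), of w] by (simp add: o_def)
      ultimately show False by simp
    qed
    then obtain i where "p i \<noteq> i" "w i \<le> w (p i)" by blast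
    then have "(\<Prod>i\<in>UNIV. B $ i $ p i) = 0"
      using off by (intro prod_zero) (auto intro!: exI[of _ i])
    then show ?thesis by simp
  qed
  have "det B = (\<Sum>p\<in>{id}. of_int (sign p) * (\<Prod>i\<in>UNIV. B $ i $ p i))"
    unfolding det_def using 0 by (intro sum.mono_neutral_right) (auto simp: permutes_id finite_permutations)
  then show ?thesis by (simp add: diag sign_id)
qed

text \<open>
  The change of variables theorems of the library require a well-ordered index type, so an
  arbitrary finite index type is copied and ordered by an injection into the natural numbers.
\<close>

typedef 'a wo = "UNIV :: 'a set" morphisms of_wo to_wo ..

instance wo :: (finite) finite
proof
  have "(UNIV :: 'a wo set) = range to_wo" by (metis of_wo_inverse surjI)
  then show "finite (UNIV :: 'a wo set)" by (metis finite finite_imageI)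
qed

definition enum_nat :: "'a::finite \<Rightarrow> nat" where "enum_nat = (SOME f. inj f)"

lemma inj_enum_nat: "inj (enum_nat :: 'a::finite \<Rightarrow> nat)"
  unfolding enum_nat_def
  using finite_imp_inj_to_nat_seg[of "UNIV :: 'a set"] by (intro someI_ex[of inj]) auto

instantiation wo :: (finite) wellorder
begin
definition "x \<le> y \<longleftrightarrow> enum_nat (of_wo x) \<le> enum_nat (of_wo y)"
definition "x < y \<longleftrightarrow> enum_nat (of_wo x) < enum_nat (of_wo y)"
instance
proof
  fix x y z :: "'a wo" and P :: "'a wo \<Rightarrow> bool"
  show "(x < y) = (x \<le> y \<and> \<not> y \<le> x)"
    unfolding less_eq_wo_def less_wo_def by linarith
  show "x \<le> x"
    unfolding less_eq_wo_def by (rule le_refl)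
  show "x \<le> z" if "x \<le> y" "y \<le> z"
    using that unfolding less_eq_wo_def by (rule le_trans)
  show "x \<le> y \<or> y \<le> x"
    unfolding less_eq_wo_def by linarith
  show "x = y" if "x \<le> y" "y \<le> x"
  proof -
    have "enum_nat (of_wo x) = enum_nat (of_wo y)"
      using that unfolding less_eq_wo_def by (rule le_antisym)
    then have "of_wo x = of_wo y" by (rule injD[OF inj_enum_nat])
    then show ?thesis by (simp only: of_wo_inject)
  qed
  assume H: "\<And>x. (\<And>y. y < x \<Longrightarrow> P y) \<Longrightarrow> P x"
  show "P x"
  proof (induct x rule: measure_induct_rule[where f = "\<lambda>x. enum_nat (of_wo x)"])
    case (less x)
    show ?case by (rule H, rule less) (simp add: less_wo_def)
  qed
qed
end

definition to_wo_vec :: "real ^ 'n \<Rightarrow> real ^ 'n wo" where "to_wo_vec x = (\<chi> i. x $ of_wo i)"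
definition of_wo_vec :: "real ^ 'n wo \<Rightarrow> real ^ 'n" where "of_wo_vec x = (\<chi> i. x $ to_wo i)"

lemma wo_vec_inverse [simp]: "to_wo_vec (of_wo_vec x) = x" "of_wo_vec (to_wo_vec y) = y"
  by (simp_all add: to_wo_vec_def of_wo_vec_def vec_eq_iff of_wo_inverse to_wo_inverse)

lemma bij_of_wo: "bij of_wo"
  by (metis UNIV_I bij_iff of_wo_inverse to_wo_inverse)

lemma linear_wo_vec: "linear to_wo_vec" "linear of_wo_vec"
  by (auto intro!: linearI simp: to_wo_vec_def of_wo_vec_def vec_eq_iff)

lemma continuous_wo_vec [continuous_intros]: "continuous_on S to_wo_vec" "continuous_on S' of_wo_vec"
  by (simp_all add: linear_wo_vec linear_continuous_on linear_conv_bounded_linear[symmetric])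

lemma measurable_wo_vec [measurable]: "to_wo_vec \<in> borel_measurable borel" "of_wo_vec \<in> borel_measurable borel"
  by (intro borel_measurable_continuous_onI continuous_wo_vec)+

lemma prod_Basis_cart: "(\<Prod>b\<in>Basis. ((x :: real ^ 'n) \<bullet> b)) = (\<Prod>i\<in>UNIV. x $ i)"
proof -
  have *: "(Basis :: (real ^ 'n) set) = range (\<lambda>i. axis i 1)" by (auto simp: Basis_vec_def)
  have "inj (\<lambda>i :: 'n. axis i (1::real))" by (simp add: axis_eq_axis inj_def)
  from prod.reindex[OF this, of "\<lambda>b. x \<bullet> b"] show ?thesis
    by (simp only: * o_def inner_axis) simp
qed

lemma lborel_eqI_cart:
  assumes "\<And>l u. (\<And>i. l $ i \<le> u $ i) \<Longrightarrow> emeasure M (box l u) = ennreal (\<Prod>i\<in>UNIV. (u - l) $ i)"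
    and "sets M = sets borel"
  shows "lborel = (M :: (real ^ 'n) measure)"
proof (rule lborel_eqI[OF _ assms(2)])
  fix l u :: "real ^ 'n" assume *: "\<And>b. b \<in> Basis \<Longrightarrow> l \<bullet> b \<le> u \<bullet> b"
  have "l $ i \<le> u $ i" for i
    using *[of "axis i 1"] by (simp add: inner_axis axis_in_Basis_iff)
  then show "emeasure M (box l u) = ennreal (\<Prod>b\<in>Basis. (u - l) \<bullet> b)"
    unfolding prod_Basis_cart by (rule assms(1))
qed

lemma emeasure_lborel_box_cart:
  assumes "\<And>i. l $ i \<le> u $ i"
  shows "emeasure lborel (box l u :: (real ^ 'n) set) = ennreal (\<Prod>i\<in>UNIV. (u - l) $ i)"
proof (subst emeasure_lborel_box)
  show "l \<bullet> b \<le> u \<bullet> b" if "b \<in> Basis" for b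
    using assms that by (auto simp: Basis_vec_def inner_axis)
qed (simp add: prod_Basis_cart)

text \<open>Relabelling coordinates carries boxes to boxes with the same side lengths, and boxes
  determine Lebesgue measure.\<close>

lemma distr_of_wo_vec: "distr lborel borel of_wo_vec = (lborel :: (real ^ 'n) measure)"
proof (rule lborel_eqI_cart[symmetric])
  fix l u :: "real ^ 'n" assume lu: "\<And>i. l $ i \<le> u $ i"
  have "of_wo_vec -` box l u = box (to_wo_vec l) (to_wo_vec u)"
  proof -
    have all: "(\<forall>i. P i) \<longleftrightarrow> (\<forall>j. P (of_wo j))" for P by (metis to_wo_inverse UNIV_I)
    have "of_wo_vec x \<in> box l u \<longleftrightarrow> x \<in> box (to_wo_vec l) (to_wo_vec u)" for x
      unfolding mem_box_cart to_wo_vec_def of_wo_vec_def by (subst all) (simp add: of_wo_inverse)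
    then show ?thesis by blast
  qed
  then have "emeasure (distr lborel borel of_wo_vec) (box l u) = emeasure lborel (box (to_wo_vec l) (to_wo_vec u))"
    by (simp add: emeasure_distr)
  also have "\<dots> = ennreal (\<Prod>i\<in>UNIV. (to_wo_vec u - to_wo_vec l) $ i)"
    by (rule emeasure_lborel_box_cart) (simp add: to_wo_vec_def lu)
  also have "(\<Prod>i\<in>UNIV. (to_wo_vec u - to_wo_vec l) $ i) = (\<Prod>i\<in>UNIV. (u - l) $ i)"
    unfolding to_wo_vec_def using prod.reindex_bij_betw[OF bij_of_wo, of "\<lambda>i. (u-l) $ i"] by simp
  finally show "emeasure (distr lborel borel of_wo_vec) (box l u) = ennreal (\<Prod>i\<in>UNIV. (u - l) $ i)" .
qed simp

text \<open>The preimage of a box under \<open>f\<close> is its image under the inverse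
  \<open>g\<close>, whose volume is the integral of |det g'| = 1. Differentiability is thus asked of
  \<open>g\<close>, measurability of \<open>f\<close>.\<close>

lemma distr_volume_preserving_wo:
  fixes f g :: "real ^ 'n::{finite,wellorder} \<Rightarrow> real ^ 'n::{finite,wellorder}"
  assumes der: "\<And>x. (g has_derivative g' x) (at x)" and det: "\<And>x. \<bar>det (matrix (g' x))\<bar> = 1"
    and fg: "\<And>x. f (g x) = x" "\<And>x. g (f x) = x" and f: "f \<in> borel_measurable borel"
  shows "distr lborel borel f = lborel"
proof (rule lborel_eqI_cart[symmetric])
  fix l u :: "real ^ 'n::{finite,wellorder}" assume lu: "\<And>i. l $ i \<le> u $ i"
  have inj: "inj_on g (box l u)" by (metis fg(1) inj_on_inverseI)
  have eq: "f -` box l u = g ` box l u"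
    by (auto simp: fg image_iff) (metis fg(2))
  have m: "(\<lambda>x. \<bar>det (matrix (g' x))\<bar>) integrable_on box l u"
    unfolding det by (simp add: integrable_on_const)
  have der': "\<And>x. x \<in> box l u \<Longrightarrow> (g has_derivative g' x) (at x within box l u)"
    using der has_derivative_at_withinI by blast
  have "g ` box l u \<in> lmeasurable"
    using measurable_differentiable_image_eq[OF _ der' inj] m by auto
  moreover have "measure lebesgue (g ` box l u) = measure lborel (box l u)"
    using measure_differentiable_image_eq[OF _ der' inj m] lmeasure_integral[OF lmeasurable_box, of l u]
    by (simp add: det)
  moreover have b: "g ` box l u \<in> sets borel"
    unfolding eq[symmetric] using measurable_sets[OF f, of "box l u"] by simp
  ultimately have "emeasure lborel (g ` box l u) = emeasure lborel (box l u)"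
    using emeasure_eq_measure2[of "g ` box l u" lebesgue] emeasure_eq_measure2[of "box l u" lborel]
      emeasure_lborel_box_finite[of l u]
    by (simp add: fmeasurable_def)
  then show "emeasure (distr lborel borel f) (box l u) = ennreal (\<Prod>i\<in>UNIV. (u - l) $ i)"
    using f lu by (simp add: emeasure_distr eq emeasure_lborel_box_cart)
qed simp

text \<open>Conjugation with the relabelling reduces this to ordered index types; the determinant is
  that of the conjugated derivative because the ordered case consumes it in this form.\<close>

lemma distr_volume_preserving:
  fixes f g :: "real ^ 'n \<Rightarrow> real ^ 'n"
  assumes der: "\<And>x. (g has_derivative g' x) (at x)"
    and det: "\<And>x. \<bar>det (matrix (to_wo_vec \<circ> g' x \<circ> of_wo_vec))\<bar> = 1"
    and fg: "\<And>x. f (g x) = x" "\<And>x. g (f x) = x" and f[measurable]: "f \<in> borel_measurable borel"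
  shows "distr lborel borel f = lborel"
proof -
  have bl: "bounded_linear to_wo_vec" "bounded_linear of_wo_vec"
    using linear_wo_vec by (simp_all add: linear_conv_bounded_linear)
  have 1: "distr lborel borel (to_wo_vec \<circ> f \<circ> of_wo_vec) = lborel"
  proof (rule distr_volume_preserving_wo[where g = "to_wo_vec \<circ> g \<circ> of_wo_vec"])
    fix x :: "real ^ 'n wo"
    show "((to_wo_vec \<circ> g \<circ> of_wo_vec) has_derivative (to_wo_vec \<circ> g' (of_wo_vec x) \<circ> of_wo_vec)) (at x)"
      unfolding o_def
      by (intro bounded_linear.has_derivative[OF bl(1)] has_derivative_compose[OF bounded_linear_imp_has_derivative[OF bl(2)] der])
  qed (simp_all add: fg det)
  have "lborel = distr (distr lborel borel (to_wo_vec \<circ> f \<circ> of_wo_vec)) borel of_wo_vec"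
    unfolding 1 by (rule distr_of_wo_vec[symmetric])
  also have "\<dots> = distr (distr lborel borel of_wo_vec) borel f"
    by (simp add: distr_distr o_def)
  also have "\<dots> = distr lborel borel f" by (simp add: distr_of_wo_vec)
  finally show ?thesis ..
qed

section \<open>Invariance of Lebesgue measure\<close>

lemma distr_lborel_uminus: "distr lborel borel uminus = (lborel :: 'a::euclidean_space measure)"
proof -
  have "(\<lambda>x :: 'a. 0 + (\<Sum>j\<in>Basis. (- 1 * (x \<bullet> j)) *\<^sub>R j)) = uminus"
    by (simp add: sum_negf euclidean_representation)
  then show ?thesis
    using lborel_affine_euclidean[of "\<lambda>_ :: 'a. - 1" 0] by (simp add: density_1)
qed

lemma has_derivative_unique_apply:
  "(f has_derivative f') (at x) \<Longrightarrow> (f has_derivative f'') (at x) \<Longrightarrow> f' v = f'' v"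
  using has_derivative_unique by metis

section \<open>The group law and its derivative\<close>

locale graded_group =
  fixes gmul :: "real ^ 'n \<Rightarrow> real ^ 'n \<Rightarrow> real ^ 'n" and \<nu> :: "'n \<Rightarrow> nat"
  assumes graded: "graded_lie_group gmul \<nu>"
begin

lemma gmul_assoc: "gmul (gmul x y) z = gmul x (gmul y z)"
  and gmul_0_left [simp]: "gmul 0 x = x"
  and gmul_0_right [simp]: "gmul x 0 = x"
  and gmul_line: "gmul (s *\<^sub>R x) (t *\<^sub>R x) = (s + t) *\<^sub>R x"
  and weight_pos: "1 \<le> \<nu> i"
  and lie_bracket_layer: "v \<in> layer \<nu> k \<Longrightarrow> w \<in> layer \<nu> l \<Longrightarrow> lie_bracket gmul v w \<in> layer \<nu> (k + l)"
  using graded unfolding graded_lie_group_def by auto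

lemma gmul_right_inverse [simp]: "gmul x (- x) = 0"
  using gmul_line[of 1 x "-1"] by simp

lemma gmul_left_inverse [simp]: "gmul (- x) x = 0"
  using gmul_line[of "-1" x 1] by simp

lemma gmul_cancel [simp]: "gmul (- x) (gmul x y) = y" "gmul x (gmul (- x) y) = y"
  by (simp_all flip: gmul_assoc)

lemma minus_gmul: "- gmul x y = gmul (- y) (- x)"
proof -
  have "gmul (gmul x y) (gmul (- y) (- x)) = 0"
    by (simp add: gmul_assoc)
  then have "gmul (- gmul x y) (gmul (gmul x y) (gmul (- y) (- x))) = - gmul x y"
    by simp
  then show ?thesis by (simp only: gmul_cancel)
qed

definition dmul :: "(real ^ 'n) \<times> (real ^ 'n) \<Rightarrow> (real ^ 'n) \<times> (real ^ 'n) \<Rightarrow> real ^ 'n" where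
  "dmul p = frechet_derivative (\<lambda>(x, y). gmul x y) (at p)"

lemma smooth_gmul: "smooth (\<lambda>(x, y). gmul x y)"
  using graded unfolding graded_lie_group_def by auto

lemma dmul: "((\<lambda>(x, y). gmul x y) has_derivative dmul p) (at p)"
  using smooth_gmul[unfolded smooth_def, rule_format, of "Suc 0"]
  unfolding dmul_def frechet_derivative_works[symmetric] C_k.simps by blast

text \<open>The second derivative of the group law is what makes \<open>frame\<close> and
  \<open>coframe\<close> differentiable in the base point.\<close>

lemma dmul_differentiable: "(\<lambda>p. dmul p v) differentiable (at p)"
  using smooth_gmul[unfolded smooth_def, rule_format, of "Suc (Suc 0)"]
  unfolding dmul_def C_k.simps by blast

lemma linear_dmul: "linear (dmul p)"
  using dmul has_derivative_linear by blast

lemma has_derivative_gmul: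
  assumes "(f has_derivative f') (at x within S)" "(g has_derivative g') (at x within S)"
  shows "((\<lambda>x. gmul (f x) (g x)) has_derivative (\<lambda>v. dmul (f x, g x) (f' v, g' v))) (at x within S)"
  using has_derivative_compose[OF has_derivative_Pair[OF assms] dmul] by simp

lemma continuous_gmul:
  assumes "continuous_on S f" "continuous_on S g"
  shows "continuous_on S (\<lambda>x. gmul (f x) (g x))"
proof -
  have "continuous_on UNIV (\<lambda>(x, y). gmul x y)"
    using dmul has_derivative_continuous continuous_at_imp_continuous_on by blast
  from continuous_on_compose2[OF this continuous_on_Pair[OF assms]] show ?thesis by simp
qed

section \<open>Translations and the left-invariant frame\<close>

definition dleft :: "real ^ 'n \<Rightarrow> real ^ 'n \<Rightarrow> real ^ 'n \<Rightarrow> real ^ 'n" where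
  "dleft x y v = dmul (x, y) (0, v)"

definition dright :: "real ^ 'n \<Rightarrow> real ^ 'n \<Rightarrow> real ^ 'n \<Rightarrow> real ^ 'n" where
  "dright x y v = dmul (x, y) (v, 0)"

lemma dmul_split: "dmul (x, y) (v, w) = dright x y v + dleft x y w"
  using linear_add[OF linear_dmul, of "(x,y)" "(v, 0)" "(0, w)"] by (simp add: dleft_def dright_def)

lemma has_derivative_dleft: "(gmul x has_derivative dleft x y) (at y)"
  unfolding dleft_def[abs_def] using has_derivative_gmul[OF has_derivative_const has_derivative_ident] by simp

lemma has_derivative_dright: "((\<lambda>x. gmul x y) has_derivative dright x y) (at x)"
  unfolding dright_def[abs_def] using has_derivative_gmul[OF has_derivative_ident has_derivative_const] by simp

lemma linear_dleft: "linear (dleft x y)"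
  using has_derivative_dleft has_derivative_linear by blast

lemma dleft_unit [simp]: "dleft 0 x v = v"
proof -
  have "gmul 0 = (\<lambda>x. x)" by auto
  then have "(gmul 0 has_derivative (\<lambda>v. v)) (at x)" by (simp add: has_derivative_ident)
  from has_derivative_unique_apply[OF has_derivative_dleft this] show ?thesis .
qed

lemma dleft_comp: "dleft x (gmul y z) (dleft y z v) = dleft (gmul x y) z v"
proof -
  have "((\<lambda>z. gmul x (gmul y z)) has_derivative (\<lambda>v. dleft x (gmul y z) (dleft y z v))) (at z)"
    by (rule has_derivative_compose[OF has_derivative_dleft has_derivative_dleft])
  moreover have "((\<lambda>z. gmul x (gmul y z)) has_derivative dleft (gmul x y) z) (at z)"
    using has_derivative_dleft[of "gmul x y" z] by (simp add: gmul_assoc[abs_def])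
  ultimately show ?thesis by (rule has_derivative_unique_apply)
qed

text \<open>Chain rule for (x z) y = x (z y), differentiated in the middle factor z at the
  unit.\<close>

lemma dright_dleft: "dright x y (dleft x 0 v) = dleft x y (dright 0 y v)"
proof -
  have "((\<lambda>z. gmul (gmul x z) y) has_derivative (\<lambda>v. dright x y (dleft x 0 v))) (at 0)"
    using has_derivative_compose[OF has_derivative_dleft[of x 0] has_derivative_dright[of y]] by simp
  moreover have "((\<lambda>z. gmul x (gmul z y)) has_derivative (\<lambda>v. dleft x y (dright 0 y v))) (at 0)"
    using has_derivative_compose[OF has_derivative_dright[of y 0] has_derivative_dleft[of x]] by simp
  ultimately show ?thesis
    unfolding gmul_assoc by (rule has_derivative_unique_apply)
qed

text \<open>Inversion is negation, so x y = - ((- y) (- x)); the two signs in the derivative cancel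
  by linearity.\<close>

lemma dright_eq: "dright x y v = dleft (- y) (- x) v"
proof -
  have "((\<lambda>x. - gmul (- y) (- x)) has_derivative (\<lambda>v. - dleft (- y) (- x) (- v))) (at x)"
    by (intro has_derivative_minus has_derivative_compose[OF _ has_derivative_dleft] has_derivative_ident)
  then have "((\<lambda>x. gmul x y) has_derivative (\<lambda>v. - dleft (- y) (- x) (- v))) (at x)"
    by (simp add: minus_gmul)
  from has_derivative_unique_apply[OF has_derivative_dright this]
  have "dright x y v = - dleft (- y) (- x) (- v)" .
  then show ?thesis by (simp add: linear_neg[OF linear_dleft])
qed

text \<open>\<open>frame x v\<close> is the value at \<open>x\<close> of the left-invariant vector field generated by \<open>v\<close>.\<close>

definition frame :: "real ^ 'n \<Rightarrow> real ^ 'n \<Rightarrow> real ^ 'n" where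
  "frame x = dleft x 0"

text \<open>The inverse of \<open>frame x\<close>, that is J(x)^(-1): translation by
  \<open>- x\<close> brings the tangent space at \<open>x\<close> back to the unit.\<close>

definition coframe :: "real ^ 'n \<Rightarrow> real ^ 'n \<Rightarrow> real ^ 'n" where
  "coframe x = dleft (- x) x"

lemma linear_frame: "linear (frame x)" and linear_coframe: "linear (coframe x)"
  unfolding frame_def coframe_def by (rule linear_dleft)+

lemma frame_0 [simp]: "frame 0 v = v"
  by (simp add: frame_def)

lemma frame_coframe [simp]: "frame x (coframe x v) = v"
  using dleft_comp[of x "- x" x v] by (simp add: frame_def coframe_def)

lemma coframe_frame [simp]: "coframe x (frame x v) = v"
  using dleft_comp[of "- x" x 0 v] by (simp add: frame_def coframe_def)

text \<open>Every left translation factors through the unit, which reduces its determinant to those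
  of \<open>frame\<close> and \<open>coframe\<close>.\<close>

lemma dleft_eq: "dleft x y v = frame (gmul x y) (coframe y v)"
  using dleft_comp[of x y 0 "coframe y v"] by (simp flip: frame_def)

text \<open>Rewrites a right translation as a left one after an adjoint map at the unit;
  \<open>dright 0 y\<close> is \<open>frame (- y)\<close> because inversion is negation.\<close>

lemma dright_eq_frame: "dright x y v = dleft x y (frame (- y) (coframe x v))"
  using dright_dleft[of x y "coframe x v"] by (simp add: dright_eq flip: frame_def)

text \<open>Differentiate \<open>(t (x + s v)) (h (x + s v)) = (t + h) (x + s v)\<close> in \<open>s\<close> at \<open>0\<close>.\<close>

lemma frame_cocycle:
  "frame (h *\<^sub>R x) ((t + h) *\<^sub>R coframe ((t + h) *\<^sub>R x) v) =
   frame (- (h *\<^sub>R x)) (t *\<^sub>R coframe (t *\<^sub>R x) v) + h *\<^sub>R v"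
proof -
  have "((\<lambda>z. gmul (t *\<^sub>R z) (h *\<^sub>R z)) has_derivative
      (\<lambda>v. dmul (t *\<^sub>R x, h *\<^sub>R x) (t *\<^sub>R v, h *\<^sub>R v))) (at x)"
    by (intro has_derivative_gmul has_derivative_scaleR_right has_derivative_ident)
  then have "((\<lambda>z. (t + h) *\<^sub>R z) has_derivative
      (\<lambda>v. dmul (t *\<^sub>R x, h *\<^sub>R x) (t *\<^sub>R v, h *\<^sub>R v))) (at x)"
    by (simp add: gmul_line)
  moreover have "((\<lambda>z. (t + h) *\<^sub>R z) has_derivative (\<lambda>v. (t + h) *\<^sub>R v)) (at x)"
    by (intro has_derivative_scaleR_right has_derivative_ident)
  ultimately have "dmul (t *\<^sub>R x, h *\<^sub>R x) (t *\<^sub>R v, h *\<^sub>R v) = (t + h) *\<^sub>R v"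
    by (rule has_derivative_unique_apply)
  then have "(t + h) *\<^sub>R v = dleft (t *\<^sub>R x) (h *\<^sub>R x)
      (frame (- (h *\<^sub>R x)) (t *\<^sub>R coframe (t *\<^sub>R x) v) + h *\<^sub>R v)" (is "_ = dleft _ _ ?w")
    by (simp add: dmul_split dright_eq_frame linear_add[OF linear_dleft]
        linear_scale[OF linear_dleft] linear_scale[OF linear_frame] linear_scale[OF linear_coframe])
  \<comment> \<open>On the right \<open>dleft_eq\<close> produces \<open>frame\<close> at the
    product of the two points, which is the point (t + h) x; applying \<open>coframe\<close> there
    cancels it.\<close>
  then have "coframe ((t + h) *\<^sub>R x) ((t + h) *\<^sub>R v) = coframe (h *\<^sub>R x) ?w"
    by (simp add: dleft_eq gmul_line)
  then show ?thesis
    by (simp add: linear_scale[OF linear_coframe])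
qed

section \<open>The bracket as the derivative of the frame\<close>

definition dframe :: "real ^ 'n \<Rightarrow> real ^ 'n \<Rightarrow> real ^ 'n" where
  "dframe x v = frechet_derivative (\<lambda>z. frame z v) (at 0) x"

lemma has_derivative_frame: "((\<lambda>z. frame z v) has_derivative (\<lambda>x. dframe x v)) (at 0)"
proof -
  have "((\<lambda>z. dmul (z, 0) (0, v)) has_derivative
     (\<lambda>x. frechet_derivative (\<lambda>p. dmul p (0, v)) (at (0,0)) (x, 0))) (at 0)"
    using has_derivative_compose[OF has_derivative_Pair[OF has_derivative_ident has_derivative_const]
      dmul_differentiable[unfolded frechet_derivative_works]] by simp
  then have "(\<lambda>z. frame z v) differentiable (at 0)"
    unfolding differentiable_def frame_def dleft_def by blast
  then show ?thesis unfolding frechet_derivative_works dframe_def .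
qed

lemma linear_dframe_left: "linear (\<lambda>x. dframe x v)"
  using has_derivative_frame has_derivative_linear by blast

lemma linear_dframe: "linear (dframe x)"
proof (rule linearI)
  fix v w :: "real ^ 'n" and c :: real
  have "((\<lambda>z. frame z (v + w)) has_derivative (\<lambda>x. dframe x v + dframe x w)) (at 0)"
    unfolding linear_add[OF linear_frame] by (intro has_derivative_add has_derivative_frame)
  from has_derivative_unique_apply[OF has_derivative_frame this]
  show "dframe x (v + w) = dframe x v + dframe x w" .
  have "((\<lambda>z. frame z (c *\<^sub>R v)) has_derivative (\<lambda>x. c *\<^sub>R dframe x v)) (at 0)"
    unfolding linear_scale[OF linear_frame] by (intro has_derivative_scaleR_right has_derivative_frame)
  from has_derivative_unique_apply[OF has_derivative_frame this]
  show "dframe x (c *\<^sub>R v) = c *\<^sub>R dframe x v" .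
qed

lemma has_vector_derivative_frame:
  "((\<lambda>t. frame (t *\<^sub>R x) v) has_vector_derivative dframe x v) (at 0)"
  unfolding has_vector_derivative_def
  using has_derivative_compose[OF has_derivative_scaleR_left[OF has_derivative_ident]
      has_derivative_frame[of v, folded scaleR_zero_left[of x]]]
  by (simp add: linear_scale[OF linear_dframe_left])

lemma has_vector_derivative_gmul_line:
  "((\<lambda>t. gmul z (t *\<^sub>R v)) has_vector_derivative frame z v) (at 0)"
  unfolding has_vector_derivative_def frame_def
  using has_derivative_compose[OF has_derivative_scaleR_left[OF has_derivative_ident]
      has_derivative_dleft[of z "0 *\<^sub>R v"]]
  by (simp add: linear_scale[OF linear_dleft])

text \<open>The line through \<open>x\<close> is a one-parameter subgroup, so the left-invariant
  field generated by \<open>x\<close> is constant along it.\<close>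

lemma frame_self: "frame (t *\<^sub>R x) x = x"
proof -
  have "((\<lambda>s. (t + s) *\<^sub>R x) has_vector_derivative x) (at 0)"
    by (auto intro!: derivative_eq_intros)
  from vector_derivative_unique_at[OF has_vector_derivative_gmul_line[of "t *\<^sub>R x" x, unfolded gmul_line] this]
  show ?thesis .
qed

lemma dframe_self: "dframe x x = 0"
  using vector_derivative_unique_at[OF has_vector_derivative_frame[of x x, unfolded frame_self]
      has_vector_derivative_const] .

text \<open>Polarises \<open>dframe_self\<close>. Exponential coordinates thus remove the symmetric
  part that the derivative of a frame may have in general, so the bracket determines all of
  it.\<close>

lemma dframe_antisym: "dframe v x = - dframe x v"
proof -
  have "dframe (x + v) (x + v) = dframe x (x + v) + dframe v (x + v)"
    by (rule linear_add[OF linear_dframe_left])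
  then have "dframe v x + dframe x v = 0"
    by (simp add: linear_add[OF linear_dframe] dframe_self add.commute)
  then show ?thesis by (simp only: eq_neg_iff_add_eq_0)
qed

text \<open>The bracket is \<open>dframe v w - dframe w v\<close>, and antisymmetry doubles the
  first term: \<open>dframe x\<close> is half of ad_x.\<close>

lemma lie_bracket_eq: "lie_bracket gmul v w = 2 *\<^sub>R dframe v w"
proof -
  have "left_deriv gmul w (\<lambda>x. x) = (\<lambda>z. frame z w)" for w
    unfolding left_deriv_def using has_vector_derivative_gmul_line vector_derivative_at by blast
  moreover have "left_deriv gmul v (\<lambda>z. frame z w) 0 = dframe v w" for v w
    unfolding left_deriv_def using vector_derivative_at[OF has_vector_derivative_frame] by simp
  ultimately show ?thesis
    unfolding lie_bracket_def by (simp add: dframe_antisym[of w v] scaleR_2)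
qed

lemma linear_axis_expansion:
  assumes "linear f" shows "f (v :: real ^ 'n) = (\<Sum>k\<in>UNIV. v $ k *\<^sub>R f (axis k 1))"
proof -
  have "f v = f (\<Sum>k\<in>UNIV. v $ k *\<^sub>R axis k 1)"
    using basis_expansion[of v] by (simp add: scalar_mult_eq_scaleR)
  then show ?thesis by (simp add: linear_sum[OF assms] linear_scale[OF assms])
qed

text \<open>Bracketing with any basis vector adds a weight of at least 1, so the image of the
  \<open>j\<close>-th basis vector has components only in weights above
  \<open>\<nu> j\<close>.\<close>

lemma dframe_axis_nth:
  assumes "\<nu> i \<le> \<nu> j" shows "dframe x (axis j 1) $ i = 0"
proof -
  have *: "dframe (axis k 1) (axis j 1) $ i = 0" for k
  proof -
    have "axis k 1 \<in> layer \<nu> (\<nu> k)" "axis j 1 \<in> layer \<nu> (\<nu> j)"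
      by (auto simp: layer_def axis_def)
    from lie_bracket_layer[OF this] show ?thesis
      using assms weight_pos[of k] unfolding lie_bracket_eq layer_def by (auto dest!: spec[of _ i])
  qed
  show ?thesis
    using linear_axis_expansion[where f = "\<lambda>x. dframe x (axis j 1)" and v = x, OF linear_dframe_left] * by simp
qed

lemma has_vector_derivative_coframe:
  fixes x v :: "real ^ 'n"
  defines "b \<equiv> \<lambda>t. t *\<^sub>R coframe (t *\<^sub>R x) v"
  shows "(b has_vector_derivative v - 2 *\<^sub>R dframe x (b t)) (at t)"
proof -
  have "((\<lambda>t. dmul (- (t *\<^sub>R x), t *\<^sub>R x) (0, v)) differentiable (at t))"
    by (rule differentiable_compose[OF dmul_differentiable]) (auto intro!: derivative_intros)
  then have "b differentiable (at t)"
    unfolding b_def coframe_def dleft_def by (intro derivative_intros)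
  then obtain b' where b': "(b has_vector_derivative b') (at t)"
    using vector_derivative_works by blast
  have "((\<lambda>h. t + h) has_vector_derivative 1) (at (0::real))"
    by (auto intro!: derivative_eq_intros simp: has_vector_derivative_def)
  with b' have bs: "((\<lambda>h. b (t + h)) has_vector_derivative b') (at 0)"
    using vector_diff_chain_at[of "\<lambda>h. t + h" 1 0 b b'] by (simp add: o_def)
  then have bk: "((\<lambda>h. b (t + h) $ k) has_real_derivative b' $ k) (at 0)" for k
    unfolding has_real_derivative_iff_has_vector_derivative
    by (rule bounded_linear.has_vector_derivative[OF bounded_linear_vec_nth])
  \<comment> \<open>Both the linear map \<open>frame\<close> and the vector it is applied to move
    with \<open>h\<close>; expanding the vector in the basis makes the product rule
    applicable.\<close>
  have "((\<lambda>h. \<Sum>k\<in>UNIV. b (t + h) $ k *\<^sub>R frame (h *\<^sub>R x) (axis k 1)) has_vector_derivative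
      (\<Sum>k\<in>UNIV. b (t + 0) $ k *\<^sub>R dframe x (axis k 1) + b' $ k *\<^sub>R frame (0 *\<^sub>R x) (axis k 1))) (at 0)"
    by (intro has_vector_derivative_sum has_vector_derivative_scaleR bk has_vector_derivative_frame)
  moreover have "(\<Sum>k\<in>UNIV. b (t + 0) $ k *\<^sub>R dframe x (axis k 1) + b' $ k *\<^sub>R frame (0 *\<^sub>R x) (axis k 1))
      = dframe x (b t) + b'"
    using linear_axis_expansion[OF linear_dframe, of x "b t"] linear_axis_expansion[OF linear_frame, of 0 b']
    by (simp add: sum.distrib)
  ultimately have 1: "((\<lambda>h. frame (h *\<^sub>R x) (b (t + h))) has_vector_derivative dframe x (b t) + b') (at 0)"
    by (simp flip: linear_axis_expansion[OF linear_frame])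
  \<comment> \<open>The other side of the cocycle identity, in which the vector is frozen at
    \<open>b t\<close> and only the map moves.\<close>
  have "((\<lambda>h. frame (h *\<^sub>R - x) (b t) + h *\<^sub>R v) has_vector_derivative dframe (- x) (b t) + v) (at 0)"
    by (intro has_vector_derivative_add has_vector_derivative_frame) (auto intro!: derivative_eq_intros)
  then have 2: "((\<lambda>h. frame (h *\<^sub>R x) (b (t + h))) has_vector_derivative - dframe x (b t) + v) (at 0)"
    unfolding b_def frame_cocycle by (simp add: linear_neg[OF linear_dframe_left])
  from vector_derivative_unique_at[OF 1 2] have "b' = v - 2 *\<^sub>R dframe x (b t)"
    by (simp add: scaleR_2 algebra_simps)
  with b' show ?thesis by simp
qed

text \<open>Induction on the weight of the row \<open>i\<close>. Row \<open>i\<close> of ad_x B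
  involves only rows \<open>k\<close> of smaller weight; such a \<open>k\<close> differs from
  \<open>j\<close>, so its entry vanishes by induction. Hence the \<open>i\<close>-th entry has the
  constant derivative \<open>axis j 1 $ i\<close>, and it is 0 at time 0.\<close>

lemma coframe_axis_nth_aux:
  assumes "\<nu> i \<le> \<nu> j"
  shows "(t *\<^sub>R coframe (t *\<^sub>R x) (axis j 1)) $ i = t * axis j 1 $ i"
  using assms
proof (induction "\<nu> i" arbitrary: i t rule: less_induct)
  case less
  define b where "b t = t *\<^sub>R coframe (t *\<^sub>R x) (axis j 1)" for t
  have IH: "b t $ k = 0" if "\<nu> k < \<nu> i" for k t
  proof -
    have "k \<noteq> j" using that less.prems by auto
    then show ?thesis
      using less.hyps[OF that, of t] less.prems that by (simp add: b_def axis_def)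
  qed
  have 0: "dframe x (b t) $ i = 0" for t
    unfolding linear_axis_expansion[OF linear_dframe, of x "b t"]
    sum_component
  proof (rule sum.neutral, rule ballI)
    fix k
    show "(b t $ k *\<^sub>R dframe x (axis k 1)) $ i = 0"
      using IH[of k t] dframe_axis_nth[of i k x] by (cases "\<nu> k < \<nu> i") auto
  qed
  have "((\<lambda>t. b t $ i - t * axis j 1 $ i) has_real_derivative 0) (at t)" for t
  proof -
    have "((\<lambda>t. b t $ i) has_real_derivative (axis j 1 - 2 *\<^sub>R dframe x (b t)) $ i) (at t)"
      unfolding has_real_derivative_iff_has_vector_derivative b_def
      by (rule bounded_linear.has_vector_derivative[OF bounded_linear_vec_nth has_vector_derivative_coframe])
    then show ?thesis using 0 by (auto intro!: derivative_eq_intros)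
  qed
  then have "b t $ i - t * axis j 1 $ i = b 0 $ i - 0 * axis j 1 $ i"
    using DERIV_isconst_all by blast
  then show ?case by (simp add: b_def)
qed

lemma coframe_axis_nth:
  assumes "\<nu> i \<le> \<nu> j" shows "coframe x (axis j 1) $ i = axis j 1 $ i"
  using coframe_axis_nth_aux[OF assms, of 1 x] by simp

section \<open>Determinants and measures under translations\<close>

definition det_wo :: "(real ^ 'n \<Rightarrow> real ^ 'n) \<Rightarrow> real" where
  "det_wo f = det (matrix (to_wo_vec \<circ> f \<circ> of_wo_vec))"

lemma det_wo_comp:
  assumes "linear f" "linear g" shows "det_wo (\<lambda>v. f (g v)) = det_wo f * det_wo g"
proof -
  have "matrix ((to_wo_vec \<circ> f \<circ> of_wo_vec) \<circ> (to_wo_vec \<circ> g \<circ> of_wo_vec)) =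
     matrix (to_wo_vec \<circ> f \<circ> of_wo_vec) ** matrix (to_wo_vec \<circ> g \<circ> of_wo_vec)"
    using assms linear_wo_vec
    by (intro matrix_compose) (auto intro!: Vector_Spaces.linear_compose simp: Real_Vector_Spaces.linear_def real_scaleR_def)
  moreover have "(to_wo_vec \<circ> f \<circ> of_wo_vec) \<circ> (to_wo_vec \<circ> g \<circ> of_wo_vec) = to_wo_vec \<circ> (\<lambda>v. f (g v)) \<circ> of_wo_vec"
    by (auto simp: o_def)
  ultimately show ?thesis by (simp add: det_wo_def det_mul)
qed

lemma det_wo_coframe: "det_wo (coframe x) = 1"
  unfolding det_wo_def
proof (rule det_unitriangular[where w = "\<lambda>i. \<nu> (of_wo i)"])
  have *: "matrix (to_wo_vec \<circ> coframe x \<circ> of_wo_vec) $ i $ j = coframe x (axis (of_wo j) 1) $ of_wo i" for i j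
  proof -
    have "of_wo_vec (axis j 1) = axis (of_wo j) (1::real)"
      by (auto simp: of_wo_vec_def vec_eq_iff axis_def of_wo_inverse to_wo_inverse)
    then show ?thesis by (simp add: matrix_def to_wo_vec_def)
  qed
  show "matrix (to_wo_vec \<circ> coframe x \<circ> of_wo_vec) $ i $ i = 1" for i
    unfolding * by (simp add: coframe_axis_nth)
  show "matrix (to_wo_vec \<circ> coframe x \<circ> of_wo_vec) $ i $ j = 0"
    if "i \<noteq> j" "\<nu> (of_wo i) \<le> \<nu> (of_wo j)" for i j
    unfolding * coframe_axis_nth[OF that(2)] using that(1) by (simp add: axis_def of_wo_inject)
qed

lemma det_wo_frame: "det_wo (frame x) = 1"
proof -
  \<comment> \<open>The identity is written as \<open>coframe 0\<close>, whose determinant is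
    already known to be 1.\<close>
  have "(\<lambda>v. frame x (coframe x v)) = coframe 0"
    by (rule ext) (simp add: coframe_def[of 0])
  then have "det_wo (\<lambda>v. frame x (coframe x v)) = 1"
    by (rule ssubst) (rule det_wo_coframe)
  then show ?thesis
    unfolding det_wo_comp[OF linear_frame linear_coframe] det_wo_coframe mult_1_right .
qed

lemma measurable_gmul [measurable (raw)]:
  assumes "f \<in> borel_measurable M" "g \<in> borel_measurable M"
  shows "(\<lambda>x. gmul (f x) (g x)) \<in> borel_measurable M"
  by (rule borel_measurable_continuous_Pair[OF assms
        continuous_gmul[OF continuous_on_fst[OF continuous_on_id] continuous_on_snd[OF continuous_on_id]]])

lemma distr_gmul_left: "distr lborel borel (gmul x) = lborel"
proof (rule distr_volume_preserving[OF has_derivative_dleft])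
  show "\<bar>det (matrix (to_wo_vec \<circ> dleft (- x) y \<circ> of_wo_vec))\<bar> = 1" for y
    using det_wo_comp[OF linear_frame linear_coframe, of "gmul (- x) y" y]
    by (simp add: det_wo_frame det_wo_coframe dleft_eq[abs_def] flip: det_wo_def)
qed simp_all

text \<open>Right translation by \<open>x\<close> is left translation by \<open>- x\<close> between
  two inversions, and an inversion is a negation, which preserves Lebesgue measure.\<close>

lemma distr_gmul_right: "distr lborel borel (\<lambda>y. gmul y x) = lborel"
proof -
  have "distr lborel borel (\<lambda>y. gmul y x) = distr lborel borel (\<lambda>y. - gmul (- x) (- y))"
    by (simp add: minus_gmul)
  also have "\<dots> = distr (distr (distr lborel borel uminus) borel (gmul (- x))) borel uminus"
    by (simp add: distr_distr o_def)
  also have "\<dots> = lborel" by (simp add: distr_lborel_uminus distr_gmul_left)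
  finally show ?thesis .
qed

text \<open>The substitution y = x z^(-1), which turns a convolution into an average of right
  translates.\<close>

lemma distr_gmul_minus: "distr lborel borel (\<lambda>z. gmul x (- z)) = lborel"
proof -
  have "distr lborel borel (\<lambda>z. gmul x (- z)) = distr (distr lborel borel uminus) borel (gmul x)"
    by (simp add: distr_distr o_def)
  then show ?thesis by (simp add: distr_lborel_uminus distr_gmul_left)
qed

end

section \<open>Square-integrable functions\<close>

definition sq_norm :: "(real ^ 'n \<Rightarrow> complex) \<Rightarrow> real" where
  "sq_norm f = (LINT x|lborel. (cmod (f x))\<^sup>2)"

definition re_inner :: "(real ^ 'n \<Rightarrow> complex) \<Rightarrow> (real ^ 'n \<Rightarrow> complex) \<Rightarrow> real" where
  "re_inner f g = (LINT x|lborel. f x \<bullet> g x)"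

lemma L2_norm_eq_sqrt: "L2_norm f = sqrt (sq_norm f)"
  by (simp add: L2_norm_def sq_norm_def)

lemma sq_norm_nonneg [simp]: "0 \<le> sq_norm f"
  by (simp add: sq_norm_def)

lemma L2_norm_nonneg [simp]: "0 \<le> L2_norm f"
  by (simp add: L2_norm_eq_sqrt)

lemma sq_norm_eq: "sq_norm f = (L2_norm f)\<^sup>2"
  by (simp add: L2_norm_eq_sqrt)

lemma L2_measurable: "f \<in> L2 \<Longrightarrow> f \<in> borel_measurable borel"
  and L2_integrable: "f \<in> L2 \<Longrightarrow> integrable lborel (\<lambda>x. (cmod (f x))\<^sup>2)"
  by (simp_all add: L2_def)

lemma L2_norm_mult_integrable:
  assumes "f \<in> L2" "g \<in> L2" shows "integrable lborel (\<lambda>x. cmod (f x) * cmod (g x))"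
proof (rule Bochner_Integration.integrable_bound)
  show "integrable lborel (\<lambda>x. (cmod (f x))\<^sup>2 + (cmod (g x))\<^sup>2)"
    using assms by (intro Bochner_Integration.integrable_add L2_integrable)
  show "(\<lambda>x. cmod (f x) * cmod (g x)) \<in> borel_measurable lborel"
    using assms[THEN L2_measurable] by simp
  have "a * b \<le> a\<^sup>2 + b\<^sup>2" if "0 \<le> a" "0 \<le> b" for a b :: real
    using sum_squares_bound[of a b] mult_nonneg_nonneg[OF that] by linarith
  then show "AE x in lborel. norm (cmod (f x) * cmod (g x)) \<le> norm ((cmod (f x))\<^sup>2 + (cmod (g x))\<^sup>2)"
    by (intro AE_I2) (simp add: abs_mult)
qed

lemma measurable_cnj [measurable]: "cnj \<in> borel_measurable borel"
  by (intro borel_measurable_continuous_onI continuous_intros)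

lemma L2_mult_cnj_integrable:
  assumes "f \<in> L2" "g \<in> L2" shows "integrable lborel (\<lambda>x. f x * cnj (g x))"
proof (rule Bochner_Integration.integrable_bound[OF L2_norm_mult_integrable[OF assms]])
  show "(\<lambda>x. f x * cnj (g x)) \<in> borel_measurable lborel"
    using assms[THEN L2_measurable] by simp
qed (simp add: norm_mult)

lemma L2_re_inner_integrable:
  assumes "f \<in> L2" "g \<in> L2" shows "integrable lborel (\<lambda>x. f x \<bullet> g x)"
  using L2_norm_mult_integrable[OF assms] assms[THEN L2_measurable]
  by (elim Bochner_Integration.integrable_bound) (auto simp: abs_mult Cauchy_Schwarz_ineq2)

lemma re_inner_eq: "f \<in> L2 \<Longrightarrow> g \<in> L2 \<Longrightarrow> re_inner f g = Re (L2_inner f g)"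
  unfolding re_inner_def L2_inner_def
  by (subst integral_Re[symmetric]) (auto simp: L2_mult_cnj_integrable inner_complex_def)

lemma L2_add: assumes "f \<in> L2" "g \<in> L2" shows "(\<lambda>x. f x + g x) \<in> L2"
proof -
  have "integrable lborel (\<lambda>x. (cmod (f x))\<^sup>2 + 2 * (f x \<bullet> g x) + (cmod (g x))\<^sup>2)"
    using assms by (intro Bochner_Integration.integrable_add integrable_mult_right L2_integrable L2_re_inner_integrable)
  moreover have "(cmod (f x + g x))\<^sup>2 = (cmod (f x))\<^sup>2 + 2 * (f x \<bullet> g x) + (cmod (g x))\<^sup>2" for x
    by (simp add: power2_norm_eq_inner inner_add_left inner_add_right inner_commute)
  ultimately show ?thesis
    using assms[THEN L2_measurable] by (simp add: L2_def)
qed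

lemma L2_cmult: assumes "f \<in> L2" shows "(\<lambda>x. c * f x) \<in> L2"
  using assms by (auto simp: L2_def norm_mult power_mult_distrib)

lemma L2_minus: "f \<in> L2 \<Longrightarrow> (\<lambda>x. - f x) \<in> L2"
  using L2_cmult[of f "- 1"] by simp

lemma L2_diff: "f \<in> L2 \<Longrightarrow> g \<in> L2 \<Longrightarrow> (\<lambda>x. f x - g x) \<in> L2"
  using L2_add[OF _ L2_minus] by simp

lemma L2_divide: "f \<in> L2 \<Longrightarrow> (\<lambda>x. f x / c) \<in> L2"
  using L2_cmult[of f "inverse c"] by (simp add: field_simps)

lemma re_inner_commute: "re_inner f g = re_inner g f"
  by (simp add: re_inner_def inner_commute)

lemma re_inner_add_right:
  "f \<in> L2 \<Longrightarrow> g \<in> L2 \<Longrightarrow> h \<in> L2 \<Longrightarrow> re_inner f (\<lambda>x. g x + h x) = re_inner f g + re_inner f h"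
  by (simp add: re_inner_def inner_add_right L2_re_inner_integrable)

lemma re_inner_scale_right:
  "re_inner f (\<lambda>x. complex_of_real c * g x) = c * re_inner f g"
  unfolding re_inner_def by (simp flip: scaleR_conv_of_real)

lemma sq_norm_scale: "sq_norm (\<lambda>x. c * f x) = (cmod c)\<^sup>2 * sq_norm f"
  by (simp add: sq_norm_def norm_mult power_mult_distrib)

lemma sq_norm_add:
  assumes "f \<in> L2" "g \<in> L2"
  shows "sq_norm (\<lambda>x. f x + g x) = sq_norm f + 2 * re_inner f g + sq_norm g"
proof -
  have "(cmod (f x + g x))\<^sup>2 = (cmod (f x))\<^sup>2 + 2 * (f x \<bullet> g x) + (cmod (g x))\<^sup>2" for x
    by (simp add: power2_norm_eq_inner inner_add_left inner_add_right inner_commute)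
  then show ?thesis
    unfolding sq_norm_def re_inner_def
    using assms by (simp add: L2_integrable L2_re_inner_integrable)
qed

lemma discriminant_le:
  fixes a b c :: real
  assumes "0 \<le> c" and "\<And>t. 0 \<le> a + 2 * t * b + t\<^sup>2 * c" shows "b\<^sup>2 \<le> a * c"
proof (cases "c = 0")
  case True
  have "b = 0"
  proof (rule ccontr)
    assume "b \<noteq> 0"
    \<comment> \<open>At this \<open>t\<close> the affine expression takes the value -1.\<close>
    then show False using assms(2)[of "- (a + 1) / (2 * b)"] True by (simp add: field_simps)
  qed
  then show ?thesis using True by simp
next
  case False
  with \<open>0 \<le> c\<close> have "0 < c" by simp
  \<comment> \<open>The quadratic attains its minimum at \<open>- b / c\<close>.\<close>
  then have "(a + 2 * (- b / c) * b + (- b / c)\<^sup>2 * c) * c = a * c - b\<^sup>2"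
    by (simp add: power2_eq_square field_simps)
  then show ?thesis
    using mult_nonneg_nonneg[OF assms(2)[of "- b / c"] \<open>0 \<le> c\<close>] by simp
qed

lemma re_inner_le:
  assumes "f \<in> L2" "g \<in> L2" shows "\<bar>re_inner f g\<bar> \<le> L2_norm f * L2_norm g"
proof -
  have "(re_inner f g)\<^sup>2 \<le> sq_norm f * sq_norm g"
  proof (rule discriminant_le[OF sq_norm_nonneg])
    fix t :: real
    have "sq_norm (\<lambda>x. f x + complex_of_real t * g x) = sq_norm f + 2 * t * re_inner f g + t\<^sup>2 * sq_norm g"
      using sq_norm_add[OF assms(1) L2_cmult[OF assms(2)]]
      by (simp add: re_inner_scale_right sq_norm_scale mult.assoc)
    then show "0 \<le> sq_norm f + 2 * t * re_inner f g + t\<^sup>2 * sq_norm g"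
      using sq_norm_nonneg by metis
  qed
  then show ?thesis
    by (simp add: L2_norm_eq_sqrt real_le_rsqrt flip: real_sqrt_mult)
qed

lemma L2_norm_triangle:
  assumes "f \<in> L2" "g \<in> L2" shows "L2_norm (\<lambda>x. f x + g x) \<le> L2_norm f + L2_norm g"
proof (rule power2_le_imp_le)
  show "(L2_norm (\<lambda>x. f x + g x))\<^sup>2 \<le> (L2_norm f + L2_norm g)\<^sup>2"
    using re_inner_le[OF assms]
    by (simp add: sq_norm_eq[symmetric] sq_norm_add[OF assms] power2_sum)
qed simp

lemma L2_norm_minus: "L2_norm (\<lambda>x. - f x) = L2_norm f"
  by (simp add: L2_norm_def)

lemma L2_norm_diff_triangle:
  assumes "f \<in> L2" "g \<in> L2" shows "L2_norm (\<lambda>x. f x - g x) \<le> L2_norm f + L2_norm g"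
  using L2_norm_triangle[OF assms(1) L2_minus[OF assms(2)]] by (simp add: L2_norm_minus)

lemma L2_norm_diff_le:
  assumes "f \<in> L2" "g \<in> L2" shows "\<bar>L2_norm f - L2_norm g\<bar> \<le> L2_norm (\<lambda>x. f x - g x)"
proof -
  have "L2_norm (\<lambda>x. g x - f x) = L2_norm (\<lambda>x. f x - g x)"
    by (simp add: L2_norm_def norm_minus_commute)
  then show ?thesis
    using L2_norm_triangle[OF L2_diff[OF assms] assms(2)] L2_norm_triangle[OF L2_diff[OF assms(2,1)] assms(1)]
    by simp
qed

text \<open>With \<open>r s\<close> the remainder of the difference quotient, \<open>d s\<close> is
  \<open>d t\<close> plus \<open>s - t\<close> times \<open>w + r s\<close>. Expanding the square
  leaves the error 2 <d t, r s> + (s - t) |w + r s|^2, which is controlled by Cauchy-Schwarz and the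
  triangle inequality.\<close>

lemma sq_norm_has_derivative:
  assumes d: "\<And>s. s \<in> {0..T} \<Longrightarrow> d s \<in> L2" and w: "has_L2_derivative T d w t" and t: "t \<in> {0..T}"
  shows "((\<lambda>s. sq_norm (d s)) has_real_derivative 2 * re_inner (d t) w) (at t within {0..T})"
proof -
  define r where "r s = (\<lambda>x. (d s x - d t x) / complex_of_real (s - t) - w x)" for s
  have wL: "w \<in> L2" and r0: "((\<lambda>s. L2_norm (r s)) \<longlongrightarrow> 0) (at t within {0..T})"
    using w by (simp_all add: has_L2_derivative_def r_def)
  have rL: "r s \<in> L2" if "s \<in> {0..T}" for s
    unfolding r_def by (intro L2_diff L2_divide d that t wL)
  have "((\<lambda>s. 2 * (L2_norm (d t) * L2_norm (r s)) + \<bar>s - t\<bar> * (L2_norm w + L2_norm (r s))\<^sup>2) \<longlongrightarrow>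
      2 * (L2_norm (d t) * 0) + \<bar>t - t\<bar> * (L2_norm w + 0)\<^sup>2) (at t within {0..T})"
    by (intro tendsto_intros r0)
  then have lim: "((\<lambda>s. 2 * (L2_norm (d t) * L2_norm (r s)) + \<bar>s - t\<bar> * (L2_norm w + L2_norm (r s))\<^sup>2) \<longlongrightarrow> 0)
      (at t within {0..T})" by simp
  have "((\<lambda>s. (sq_norm (d s) - sq_norm (d t)) / (s - t) - 2 * re_inner (d t) w) \<longlongrightarrow> 0) (at t within {0..T})"
  proof (rule Lim_null_comparison[OF _ lim])
    have "norm ((sq_norm (d s) - sq_norm (d t)) / (s - t) - 2 * re_inner (d t) w) \<le>
        2 * (L2_norm (d t) * L2_norm (r s)) + \<bar>s - t\<bar> * (L2_norm w + L2_norm (r s))\<^sup>2"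
      if s: "s \<in> {0..T}" "s \<noteq> t" for s
    proof -
      let ?q = "\<lambda>x. w x + r s x"
      have qL: "?q \<in> L2" by (intro L2_add wL rL s)
      have "d s = (\<lambda>x. d t x + complex_of_real (s - t) * ?q x)"
        using s(2) by (auto simp: r_def)
      then have "sq_norm (d s) = sq_norm (\<lambda>x. d t x + complex_of_real (s - t) * ?q x)" by simp
      also have "\<dots> = sq_norm (d t) + 2 * ((s - t) * (re_inner (d t) w + re_inner (d t) (r s))) + (s - t)\<^sup>2 * sq_norm ?q"
        by (subst sq_norm_add[OF d[OF t] L2_cmult[OF qL]])
          (simp only: re_inner_scale_right sq_norm_scale re_inner_add_right[OF d[OF t] wL rL[OF s(1)]]
            norm_of_real power2_abs)
      finally have "(sq_norm (d s) - sq_norm (d t)) / (s - t) - 2 * re_inner (d t) w =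
          2 * re_inner (d t) (r s) + (s - t) * sq_norm ?q"
        using s(2) by (simp add: field_simps power2_eq_square)
      moreover have "\<bar>re_inner (d t) (r s)\<bar> \<le> L2_norm (d t) * L2_norm (r s)"
        by (rule re_inner_le[OF d[OF t] rL[OF s(1)]])
      moreover have "\<bar>(s - t) * sq_norm ?q\<bar> \<le> \<bar>s - t\<bar> * (L2_norm w + L2_norm (r s))\<^sup>2"
        unfolding abs_mult sq_norm_eq using L2_norm_triangle[OF wL rL[OF s(1)]]
        by (intro mult_left_mono) (auto intro!: power_mono)
      ultimately show ?thesis by simp
    qed
    then show "\<forall>\<^sub>F s in at t within {0..T}. norm ((sq_norm (d s) - sq_norm (d t)) / (s - t) - 2 * re_inner (d t) w) \<le>
        2 * (L2_norm (d t) * L2_norm (r s)) + \<bar>s - t\<bar> * (L2_norm w + L2_norm (r s))\<^sup>2"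
      by (auto simp: eventually_at_filter)
  qed
  then show ?thesis
    unfolding has_field_derivative_iff by (rule LIM_zero_cancel)
qed

lemma has_L2_derivative_diff:
  assumes u: "\<And>s. s \<in> {0..T} \<Longrightarrow> u s \<in> L2" "\<And>s. s \<in> {0..T} \<Longrightarrow> v s \<in> L2" and t: "t \<in> {0..T}"
    and w: "has_L2_derivative T u w t" "has_L2_derivative T v w' t"
  shows "has_L2_derivative T (\<lambda>s x. u s x - v s x) (\<lambda>x. w x - w' x) t"
  unfolding has_L2_derivative_def
proof
  have wL: "w \<in> L2" "w' \<in> L2" using w by (simp_all add: has_L2_derivative_def)
  then show "(\<lambda>x. w x - w' x) \<in> L2" by (rule L2_diff)
  let ?q = "\<lambda>u w s x. (u s x - u t x) / complex_of_real (s - t) - w x"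
  have lim: "((\<lambda>s. L2_norm (?q u w s) + L2_norm (?q v w' s)) \<longlongrightarrow> 0) (at t within {0..T})"
    using w unfolding has_L2_derivative_def by (intro tendsto_add_zero) blast+
  show "((\<lambda>s. L2_norm (\<lambda>x. ((u s x - v s x) - (u t x - v t x)) / complex_of_real (s - t) - (w x - w' x))) \<longlongrightarrow> 0)
      (at t within {0..T})"
  proof (rule Lim_null_comparison[OF _ lim])
    have "norm (L2_norm (\<lambda>x. ((u s x - v s x) - (u t x - v t x)) / complex_of_real (s - t) - (w x - w' x)))
        \<le> L2_norm (?q u w s) + L2_norm (?q v w' s)" if s: "s \<in> {0..T}" for s
    proof -
      have "?q u w s \<in> L2" "?q v w' s \<in> L2"
        by (intro L2_diff L2_divide u s t wL)+
      moreover have "(\<lambda>x. ((u s x - v s x) - (u t x - v t x)) / complex_of_real (s - t) - (w x - w' x)) =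
          (\<lambda>x. ?q u w s x - ?q v w' s x)"
        by (rule ext) (simp add: diff_divide_distrib)
      ultimately show ?thesis
        using L2_norm_diff_triangle[of "?q u w s" "?q v w' s"] by (simp only: real_norm_def abs_of_nonneg L2_norm_nonneg)
    qed
    then show "\<forall>\<^sub>F s in at t within {0..T}. norm (L2_norm (\<lambda>x. ((u s x - v s x) - (u t x - v t x)) / complex_of_real (s - t) - (w x - w' x)))
        \<le> L2_norm (?q u w s) + L2_norm (?q v w' s)"
      by (auto simp: eventually_at_filter)
  qed
qed

lemma continuous_L2_diff:
  assumes "continuous_L2 T u" "continuous_L2 T v"
  shows "continuous_L2 T (\<lambda>s x. u s x - v s x)"
  unfolding continuous_L2_def
proof (intro ballI conjI)
  fix t assume t: "t \<in> {0..T}"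
  have L: "u s \<in> L2" "v s \<in> L2" if "s \<in> {0..T}" for s
    using assms that by (auto simp: continuous_L2_def)
  then show "(\<lambda>x. u t x - v t x) \<in> L2" using t by (intro L2_diff)
  have lim: "((\<lambda>s. L2_norm (\<lambda>x. u s x - u t x) + L2_norm (\<lambda>x. v s x - v t x)) \<longlongrightarrow> 0) (at t within {0..T})"
    using assms t unfolding continuous_L2_def by (intro tendsto_add_zero) blast+
  show "((\<lambda>s. L2_norm (\<lambda>x. u s x - v s x - (u t x - v t x))) \<longlongrightarrow> 0) (at t within {0..T})"
  proof (rule Lim_null_comparison[OF _ lim])
    have "norm (L2_norm (\<lambda>x. u s x - v s x - (u t x - v t x)))
        \<le> L2_norm (\<lambda>x. u s x - u t x) + L2_norm (\<lambda>x. v s x - v t x)" if s: "s \<in> {0..T}" for s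
    proof -
      have "(\<lambda>x. u s x - v s x - (u t x - v t x)) = (\<lambda>x. (u s x - u t x) - (v s x - v t x))"
        by (rule ext) simp
      then show ?thesis
        using L2_norm_diff_triangle[OF L2_diff[OF L(1)[OF s] L(1)[OF t]] L2_diff[OF L(2)[OF s] L(2)[OF t]]]
        by (simp only: real_norm_def abs_of_nonneg L2_norm_nonneg)
    qed
    then show "\<forall>\<^sub>F s in at t within {0..T}. norm (L2_norm (\<lambda>x. u s x - v s x - (u t x - v t x)))
        \<le> L2_norm (\<lambda>x. u s x - u t x) + L2_norm (\<lambda>x. v s x - v t x)"
      by (auto simp: eventually_at_filter)
  qed
qed

lemma continuous_on_L2_norm:
  assumes "continuous_L2 T u" shows "continuous_on {0..T} (\<lambda>t. L2_norm (u t))"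
  unfolding continuous_on_def
proof
  fix t assume t: "t \<in> {0..T}"
  have L: "u s \<in> L2" if "s \<in> {0..T}" for s
    using assms that by (auto simp: continuous_L2_def)
  have lim: "((\<lambda>s. L2_norm (\<lambda>x. u s x - u t x)) \<longlongrightarrow> 0) (at t within {0..T})"
    using assms t by (simp add: continuous_L2_def)
  have "((\<lambda>s. L2_norm (u s) - L2_norm (u t)) \<longlongrightarrow> 0) (at t within {0..T})"
    by (rule Lim_null_comparison[OF _ lim])
      (use L2_norm_diff_le[OF L L[OF t]] in \<open>auto simp: eventually_at_filter\<close>)
  then show "((\<lambda>s. L2_norm (u s)) \<longlongrightarrow> L2_norm (u t)) (at t within {0..T})"
    by (rule LIM_zero_cancel)
qed

section \<open>The energy estimate\<close>

lemma re_inner_minus_right: "re_inner f (\<lambda>x. - g x) = - re_inner f g"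
  by (simp add: re_inner_def)

lemma re_inner_diff_right:
  "f \<in> L2 \<Longrightarrow> g \<in> L2 \<Longrightarrow> h \<in> L2 \<Longrightarrow> re_inner f (\<lambda>x. g x - h x) = re_inner f g - re_inner f h"
  by (simp add: re_inner_def inner_diff_right L2_re_inner_integrable)

lemma L2_inner_diff_right:
  assumes "f \<in> L2" "g \<in> L2" "h \<in> L2"
  shows "L2_inner f (\<lambda>x. g x - h x) = L2_inner f g - L2_inner f h"
  using L2_mult_cnj_integrable[OF assms(1,2)] L2_mult_cnj_integrable[OF assms(1,3)]
  by (simp add: L2_inner_def right_diff_distrib)

lemma L2_adjoint_diff:
  assumes "A \<subseteq> L2 \<times> L2" "(f, g) \<in> L2_adjoint A" "(f', g') \<in> L2_adjoint A"
  shows "(\<lambda>x. f x - f' x, \<lambda>x. g x - g' x) \<in> L2_adjoint A"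
proof -
  have *: "f \<in> L2" "g \<in> L2" "f' \<in> L2" "g' \<in> L2"
    using assms(2,3) by (auto simp: L2_adjoint_def)
  have "L2_inner q (\<lambda>x. f x - f' x) = L2_inner p (\<lambda>x. g x - g' x)" if "(p, q) \<in> A" for p q
  proof -
    have "p \<in> L2" "q \<in> L2" using that assms(1) by auto
    moreover have "L2_inner q f = L2_inner p g" "L2_inner q f' = L2_inner p g'"
      using assms(2,3) that by (auto simp: L2_adjoint_def)
    ultimately show ?thesis using * by (simp add: L2_inner_diff_right)
  qed
  then show ?thesis using * by (auto simp: L2_adjoint_def L2_diff)
qed

text \<open>The inner product is jointly continuous, so its sign survives limits in the graph norm.
  This carries positivity from the test functions to the whole self-adjoint extension.\<close>

lemma L2_closure_re_inner_nonneg: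
  assumes B: "\<And>p q. (p, q) \<in> B \<Longrightarrow> p \<in> L2 \<and> q \<in> L2 \<and> 0 \<le> re_inner p q"
    and fg: "(f, g) \<in> L2_closure B"
  shows "0 \<le> re_inner f g"
proof -
  obtain p q where pq: "\<And>k::nat. (p k, q k) \<in> B"
    and p: "(\<lambda>k. L2_norm (\<lambda>x. p k x - f x)) \<longlonglongrightarrow> 0" and q: "(\<lambda>k. L2_norm (\<lambda>x. q k x - g x)) \<longlonglongrightarrow> 0"
    and L: "f \<in> L2" "g \<in> L2"
    using fg by (auto simp: L2_closure_def)
  define a b where "a k = L2_norm (\<lambda>x. p k x - f x)" and "b k = L2_norm (\<lambda>x. q k x - g x)" for k
  \<comment> \<open>Telescoping: <p, q> - <f, g> = <q, p - f> + <f, q - g>, where |q| is at most |g|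
    + b.\<close>
  have "- (L2_norm f * b k + (L2_norm g + b k) * a k) \<le> re_inner f g" for k
  proof -
    have pL: "p k \<in> L2" and qL: "q k \<in> L2" and nonneg: "0 \<le> re_inner (p k) (q k)"
      using B[OF pq[of k]] by auto
    have dL: "(\<lambda>x. p k x - f x) \<in> L2" "(\<lambda>x. q k x - g x) \<in> L2"
      by (intro L2_diff pL qL L)+
    have "re_inner (p k) (q k) = re_inner (q k) (\<lambda>x. p k x - f x) + re_inner f (q k)"
      using pL qL L by (simp add: re_inner_diff_right re_inner_commute[of _ "q k"])
    also have "re_inner f (q k) = re_inner f (\<lambda>x. q k x - g x) + re_inner f g"
      using qL L by (simp add: re_inner_diff_right)
    finally have "re_inner (p k) (q k) = re_inner (q k) (\<lambda>x. p k x - f x) + re_inner f (\<lambda>x. q k x - g x) + re_inner f g"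
      by simp
    moreover have "\<bar>re_inner f (\<lambda>x. q k x - g x)\<bar> \<le> L2_norm f * b k"
      unfolding b_def by (rule re_inner_le[OF L(1) dL(2)])
    moreover have "\<bar>re_inner (q k) (\<lambda>x. p k x - f x)\<bar> \<le> L2_norm (q k) * a k"
      unfolding a_def by (rule re_inner_le[OF qL dL(1)])
    moreover have "L2_norm (q k) * a k \<le> (L2_norm g + b k) * a k"
      using L2_norm_diff_le[OF qL L(2)] unfolding a_def b_def by (intro mult_right_mono) auto
    ultimately show ?thesis using nonneg by linarith
  qed
  moreover have "(\<lambda>k. - (L2_norm f * b k + (L2_norm g + b k) * a k)) \<longlonglongrightarrow> - (L2_norm f * 0 + (L2_norm g + 0) * 0)"
    using p q unfolding a_def[symmetric] b_def[symmetric] by (intro tendsto_intros)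
  ultimately have "- (L2_norm f * 0 + (L2_norm g + 0) * 0) \<le> re_inner f g"
    by (intro LIMSEQ_le_const2) auto
  then show ?thesis by simp
qed

text \<open>\<open>F\<close> stands in for the product \<open>V d + W u\<close>, as \<open>V\<close> and \<open>W\<close> need not be measurable.\<close>

lemma re_inner_potential_le:
  assumes L: "d \<in> L2" "F \<in> L2" "u \<in> L2"
    and F: "AE x in lborel. F x = V x * d x + W x * u x"
    and V: "\<And>x. cmod (V x) \<le> M" and W: "\<And>x. cmod (W x) \<le> \<delta>"
  shows "\<bar>2 * re_inner d F\<bar> \<le> (2 * M + 1) * sq_norm d + \<delta>\<^sup>2 * sq_norm u"
proof -
  have "\<bar>2 * re_inner d F\<bar> \<le> (LINT x|lborel. \<bar>2 * (d x \<bullet> F x)\<bar>)"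
    using integral_abs_bound[of lborel "\<lambda>x. 2 * (d x \<bullet> F x)"] by (simp add: re_inner_def)
  also have "\<dots> \<le> (LINT x|lborel. (2 * M + 1) * (cmod (d x))\<^sup>2 + \<delta>\<^sup>2 * (cmod (u x))\<^sup>2)"
  proof (rule integral_mono_AE)
    show "AE x in lborel. \<bar>2 * (d x \<bullet> F x)\<bar> \<le> (2 * M + 1) * (cmod (d x))\<^sup>2 + \<delta>\<^sup>2 * (cmod (u x))\<^sup>2"
      using F
    proof eventually_elim
      case (elim x)
      have "\<bar>d x \<bullet> F x\<bar> \<le> cmod (d x) * cmod (F x)" by (rule Cauchy_Schwarz_ineq2)
      also have "cmod (F x) \<le> M * cmod (d x) + \<delta> * cmod (u x)"
        unfolding elim using V[of x] W[of x]
        by (intro norm_triangle_le) (auto simp: norm_mult intro!: add_mono mult_right_mono)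
      finally have "\<bar>d x \<bullet> F x\<bar> \<le> cmod (d x) * (M * cmod (d x) + \<delta> * cmod (u x))"
        by (simp add: mult_left_mono)
      \<comment> \<open>The mixed term 2 |d| \<delta> |u| is split as |d|^2 + \<delta>^2 |u|^2,
        which keeps the coefficient of |d|^2 independent of \<delta>.\<close>
      then show ?case
        using sum_squares_bound[of "cmod (d x)" "\<delta> * cmod (u x)"]
        by (simp add: algebra_simps power2_eq_square)
    qed
  qed (use L in \<open>auto intro!: integrable_abs L2_re_inner_integrable Bochner_Integration.integrable_add L2_integrable\<close>)
  also have "\<dots> = (2 * M + 1) * sq_norm d + \<delta>\<^sup>2 * sq_norm u"
    unfolding sq_norm_def using L by (simp add: L2_integrable)
  finally show ?thesis .
qed

text \<open>The function \<open>exp (- c * s) * D s - K * s\<close> is nonincreasing. A derivative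
  is asked for only in the open interval: the equation says nothing at time 0, and at
  \<open>T\<close> the derivative is one-sided.\<close>

lemma gronwall_open:
  fixes D :: "real \<Rightarrow> real"
  assumes cont: "continuous_on {0..T} D"
    and der: "\<And>t. 0 < t \<Longrightarrow> t < T \<Longrightarrow> \<exists>D'. (D has_real_derivative D') (at t) \<and> D' \<le> c * D t + K"
    and "0 \<le> K" "0 \<le> c" and t: "t \<in> {0..T}"
  shows "D t \<le> exp (c * t) * (D 0 + K * t)"
proof -
  define g where "g s = exp (- c * s) * D s - K * s" for s
  have "g t \<le> g 0"
  proof (rule DERIV_nonpos_imp_decreasing_open[where f = g and a = 0 and b = t])
    show "0 \<le> t" using t by simp
    show "continuous_on {0..t} g"
      unfolding g_def using t by (intro continuous_intros continuous_on_subset[OF cont]) auto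
    fix s assume s: "0 < s" "s < t"
    then obtain D' where D': "(D has_real_derivative D') (at s)" "D' \<le> c * D s + K"
      using der[of s] t by auto
    have "(g has_real_derivative exp (- c * s) * (D' - c * D s) - K) (at s)"
      unfolding g_def by (auto intro!: derivative_eq_intros D'(1) simp: algebra_simps)
    moreover have "exp (- c * s) * (D' - c * D s) \<le> 1 * K"
    proof -
      have "exp (- c * s) * (D' - c * D s) \<le> exp (- c * s) * K"
        using D'(2) by (intro mult_left_mono) auto
      also have "\<dots> \<le> 1 * K"
        using \<open>0 \<le> K\<close> \<open>0 \<le> c\<close> s by (intro mult_right_mono) auto
      finally show ?thesis .
    qed
    ultimately show "\<exists>y. (g has_real_derivative y) (at s) \<and> y \<le> 0" by (intro exI conjI) auto
  qed
  then have "exp (c * t) * (exp (- c * t) * D t) \<le> exp (c * t) * (D 0 + K * t)"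
    unfolding g_def by (intro mult_left_mono) auto
  then show ?thesis
    by (simp add: mult.assoc[symmetric] flip: exp_add)
qed

text \<open>The operator enters only through closure under differences and nonnegativity, the
  potentials only through bounds on moduli. Uniqueness and convergence are both instances: equal
  potentials with \<delta> = 0, or close ones.\<close>

lemma heat_solution_energy:
  assumes diff: "\<And>f g f' g'. (f, g) \<in> A \<Longrightarrow> (f', g') \<in> A \<Longrightarrow> (\<lambda>x. f x - f' x, \<lambda>x. g x - g' x) \<in> A"
    and A: "\<And>f g. (f, g) \<in> A \<Longrightarrow> f \<in> L2 \<and> g \<in> L2 \<and> 0 \<le> re_inner f g"
    and u1: "heat_solution A V1 T a1 u1" and u2: "heat_solution A V2 T a2 u2"
    and V1: "\<And>x. cmod (V1 x) \<le> M" and V: "\<And>x. cmod (V1 x - V2 x) \<le> \<delta>"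
    and K: "\<And>t. t \<in> {0..T} \<Longrightarrow> sq_norm (u2 t) \<le> K" and t: "t \<in> {0..T}"
  shows "sq_norm (\<lambda>x. u1 t x - u2 t x) \<le>
     exp ((2 * M + 1) * t) * (sq_norm (\<lambda>x. u1 0 x - u2 0 x) + \<delta>\<^sup>2 * K * t)"
proof (rule gronwall_open[OF _ _ _ _ t])
  let ?d = "\<lambda>t x. u1 t x - u2 t x"
  have c: "continuous_L2 T u1" "continuous_L2 T u2"
    using u1 u2 by (auto simp: heat_solution_def)
  then have L: "u1 t \<in> L2" "u2 t \<in> L2" if "t \<in> {0..T}" for t
    using that by (auto simp: continuous_L2_def)
  show "continuous_on {0..T} (\<lambda>t. sq_norm (?d t))"
    unfolding sq_norm_eq by (intro continuous_intros continuous_on_L2_norm continuous_L2_diff c)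
  have "0 \<le> K" using K[OF t] sq_norm_nonneg order_trans by blast
  then show "0 \<le> \<delta>\<^sup>2 * K" by simp
  have "0 \<le> M" using V1 norm_ge_zero order_trans by blast
  then show "0 \<le> 2 * M + 1" by simp
  fix s assume s: "0 < s" "s < T"
  then have s': "s \<in> {0..T}" "s \<in> {0<..T}" by auto
  obtain w1 g1 where 1: "has_L2_derivative T u1 w1 s" "(u1 s, g1) \<in> A"
    "AE x in lborel. w1 x + g1 x + V1 x * u1 s x = 0"
    using u1 s' unfolding heat_solution_def by blast
  obtain w2 g2 where 2: "has_L2_derivative T u2 w2 s" "(u2 s, g2) \<in> A"
    "AE x in lborel. w2 x + g2 x + V2 x * u2 s x = 0"
    using u2 s' unfolding heat_solution_def by blast
  define w where "w = (\<lambda>x. w1 x - w2 x)"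
  define g where "g = (\<lambda>x. g1 x - g2 x)"
  define F where "F = (\<lambda>x. - w x - g x)"
  have dg: "(?d s, g) \<in> A" unfolding g_def by (rule diff[OF 1(2) 2(2)])
  then have dL: "?d s \<in> L2" and gL: "g \<in> L2" and pos: "0 \<le> re_inner (?d s) g"
    using A by blast+
  have wd: "has_L2_derivative T ?d w s"
    unfolding w_def by (rule has_L2_derivative_diff[OF L s'(1) 1(1) 2(1)])
  then have wL: "w \<in> L2" by (simp add: has_L2_derivative_def)
  have FL: "F \<in> L2" unfolding F_def by (intro L2_diff L2_minus wL gL)
  \<comment> \<open>Uses V1 u1 - V2 u2 = V1 (u1 - u2) + (V1 - V2) u2, so that the difference of the
    potentials meets only the second solution.\<close>
  have "AE x in lborel. F x = V1 x * ?d s x + (V1 x - V2 x) * u2 s x"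
    using 1(3) 2(3)
  proof eventually_elim
    case (elim x)
    then show ?case unfolding F_def w_def g_def by algebra
  qed
  from re_inner_potential_le[OF dL FL L(2)[OF s'(1)] this V1 V]
  have "\<bar>2 * re_inner (?d s) F\<bar> \<le> (2 * M + 1) * sq_norm (?d s) + \<delta>\<^sup>2 * sq_norm (u2 s)" .
  moreover have "\<delta>\<^sup>2 * sq_norm (u2 s) \<le> \<delta>\<^sup>2 * K"
    using K[OF s'(1)] by (simp add: mult_left_mono)
  moreover have "re_inner (?d s) F = - re_inner (?d s) w - re_inner (?d s) g"
    unfolding F_def by (subst re_inner_diff_right) (simp_all add: re_inner_minus_right L2_minus wL gL dL)
  ultimately have "2 * re_inner (?d s) w \<le> (2 * M + 1) * sq_norm (?d s) + \<delta>\<^sup>2 * K"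
    using pos by linarith
  moreover have "((\<lambda>s. sq_norm (?d s)) has_real_derivative 2 * re_inner (?d s) w) (at s)"
    using sq_norm_has_derivative[OF L2_diff[OF L] wd s'(1)] s by (simp add: at_within_Icc_at)
  ultimately show "\<exists>D'. ((\<lambda>s. sq_norm (?d s)) has_real_derivative D') (at s) \<and>
      D' \<le> (2 * M + 1) * sq_norm (?d s) + \<delta>\<^sup>2 * K" by blast
qed

section \<open>Test functions and the self-adjoint extension\<close>

lemma smooth_partial_deriv: "smooth f \<Longrightarrow> smooth (partial_deriv i f)"
  unfolding smooth_def partial_deriv_def[abs_def] by (metis C_k.simps(2))

lemma smooth_continuous: "smooth f \<Longrightarrow> continuous_on UNIV f"
  unfolding smooth_def by (metis C_k.simps(1))

lemma smooth_foldr_partial_deriv: "smooth f \<Longrightarrow> smooth (foldr partial_deriv \<alpha> f)"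
  by (induction \<alpha>) (auto simp: smooth_partial_deriv)

lemma partial_deriv_eq_0:
  assumes "open U" "\<And>x. x \<in> U \<Longrightarrow> f x = 0" "x \<in> U" shows "partial_deriv i f x = 0"
proof -
  have "(f has_derivative (\<lambda>_. 0)) (at x)"
    using has_derivative_transform_within_open[OF has_derivative_const[of 0] assms(1,3), of f] assms(2) by simp
  then show ?thesis by (simp add: partial_deriv_def frechet_derivative_at[symmetric])
qed

lemma foldr_partial_deriv_eq_0:
  assumes "open U" "\<And>x. x \<in> U \<Longrightarrow> f x = 0" "x \<in> U" shows "foldr partial_deriv \<alpha> f x = 0"
  using assms(3) by (induction \<alpha> arbitrary: x) (auto intro: assms(2) partial_deriv_eq_0[OF assms(1)])

lemma continuous_compact_support_L2:
  assumes "continuous_on UNIV f" "compact K" "\<And>x. x \<notin> K \<Longrightarrow> f x = 0"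
  shows "f \<in> L2"
proof -
  have "integrable lborel (\<lambda>x. indicator K x *\<^sub>R (cmod (f x))\<^sup>2)"
    using assms(1,2) by (intro borel_integrable_compact continuous_intros) (auto intro: continuous_on_subset)
  moreover have "indicator K x *\<^sub>R (cmod (f x))\<^sup>2 = (cmod (f x))\<^sup>2" for x
    using assms(3)[of x] by (auto simp: indicator_def)
  ultimately have "integrable lborel (\<lambda>x. (cmod (f x))\<^sup>2)"
    by (simp only:)
  then show ?thesis
    using assms(1) by (simp add: L2_def borel_measurable_continuous_onI)
qed

text \<open>Differential operators do not enlarge supports: all derivatives of \<phi> vanish on the
  open complement of \<open>K\<close>. Square integrability makes the inner products in the
  positivity hypothesis genuine integrals.\<close>

lemma differential_operator_L2:
  assumes R: "differential_operator R" and \<phi>: "\<phi> \<in> test_functions"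
  shows "\<phi> \<in> L2" "R \<phi> \<in> L2"
proof -
  have s: "smooth \<phi>" using \<phi> by (simp add: test_functions_def)
  obtain K where K: "compact K" "\<And>x. x \<notin> K \<Longrightarrow> \<phi> x = 0"
    using \<phi> closure_subset[of "{x. \<phi> x \<noteq> 0}"] unfolding test_functions_def by blast
  show "\<phi> \<in> L2"
    by (rule continuous_compact_support_L2[OF smooth_continuous[OF s] K])
  obtain S a where S: "\<And>\<alpha>. \<alpha> \<in> S \<Longrightarrow> smooth (a \<alpha>)"
    "\<And>x. R \<phi> x = (\<Sum>\<alpha>\<in>S. a \<alpha> x * foldr partial_deriv \<alpha> \<phi> x)"
    using R s unfolding differential_operator_def by blast
  have "continuous_on UNIV (\<lambda>x. \<Sum>\<alpha>\<in>S. a \<alpha> x * foldr partial_deriv \<alpha> \<phi> x)"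
    by (intro continuous_intros smooth_continuous smooth_foldr_partial_deriv s S(1))
  then have "continuous_on UNIV (R \<phi>)"
    unfolding S(2)[symmetric] .
  then show "R \<phi> \<in> L2"
  proof (rule continuous_compact_support_L2[OF _ K(1)])
    fix x assume x: "x \<notin> K"
    have "foldr partial_deriv \<alpha> \<phi> x = 0" for \<alpha>
      using K x by (intro foldr_partial_deriv_eq_0[of "- K"]) (auto intro: open_Compl compact_imp_closed)
    then show "R \<phi> x = 0" by (simp add: S(2))
  qed
qed

text \<open>Read off from \<open>L2_adjoint A = A\<close>, since the condition defining an adjoint
  graph is linear in the pair; this avoids manipulating approximating sequences.\<close>

lemma self_adjoint_extension_diff:
  assumes "self_adjoint_extension R A" "(f, g) \<in> A" "(f', g') \<in> A"
  shows "(\<lambda>x. f x - f' x, \<lambda>x. g x - g' x) \<in> A"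
proof -
  have adj: "L2_adjoint A = A" using assms(1) unfolding self_adjoint_extension_def by (rule conjunct1)
  have "L2_adjoint A \<subseteq> L2 \<times> L2" unfolding L2_adjoint_def by blast
  then show ?thesis
    using assms(2,3) L2_adjoint_diff[of A f g f' g'] unfolding adj by blast
qed

lemma self_adjoint_extension_nonneg:
  assumes "self_adjoint_extension R A" "differential_operator R" "positive_operator R" "(f, g) \<in> A"
  shows "f \<in> L2 \<and> g \<in> L2 \<and> 0 \<le> re_inner f g"
proof -
  have A: "A = L2_closure {(\<phi>, R \<phi>) | \<phi>. \<phi> \<in> test_functions}"
    using assms(1) unfolding self_adjoint_extension_def by (rule conjunct2)
  have *: "p \<in> L2 \<and> q \<in> L2 \<and> 0 \<le> re_inner p q" if "(p, q) \<in> {(\<phi>, R \<phi>) | \<phi>. \<phi> \<in> test_functions}" for p q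
  proof -
    have "p \<in> test_functions" "q = R p" using that by auto
    then show ?thesis
      using assms(3) differential_operator_L2[OF assms(2)]
      by (auto simp: re_inner_commute[of p] re_inner_eq positive_operator_def)
  qed
  have fg: "(f, g) \<in> L2_closure {(\<phi>, R \<phi>) | \<phi>. \<phi> \<in> test_functions}"
    using assms(4) unfolding A .
  have "0 \<le> re_inner f g" by (rule L2_closure_re_inner_nonneg[OF * fg])
  with fg show ?thesis unfolding L2_closure_def by blast
qed

section \<open>Approximate identities\<close>

lemma L2_norm_tendsto_0_dominated:
  fixes h :: "nat \<Rightarrow> real ^ 'n \<Rightarrow> complex"
  assumes meas: "\<And>k. h k \<in> borel_measurable borel"
    and lim: "AE x in lborel. (\<lambda>k. h k x) \<longlonglongrightarrow> 0"
    and w: "integrable lborel w" "\<And>k x. (cmod (h k x))\<^sup>2 \<le> w x"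
  shows "(\<lambda>k. L2_norm (h k)) \<longlonglongrightarrow> 0"
proof -
  have "(\<lambda>k. LINT x|lborel. (cmod (h k x))\<^sup>2) \<longlonglongrightarrow> (LINT x :: real ^ 'n|lborel. 0 :: real)"
  proof (rule integral_dominated_convergence[OF _ _ w(1)])
    show "AE x in lborel. (\<lambda>k. (cmod (h k x))\<^sup>2) \<longlonglongrightarrow> 0"
      using lim by eventually_elim (auto intro!: tendsto_eq_intros)
  qed (use meas w(2) in \<open>auto intro!: AE_I2\<close>)
  then have "(\<lambda>k. sqrt (LINT x|lborel. (cmod (h k x))\<^sup>2)) \<longlonglongrightarrow> sqrt 0"
    by (intro tendsto_real_sqrt) simp
  then show ?thesis by (simp add: L2_norm_def)
qed

text \<open>Truncate argument and value at the same \<open>n\<close>; the error is dominated by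
  \<open>f\<close> itself.\<close>

lemma L2_approx_bounded:
  fixes f :: "real ^ 'n \<Rightarrow> complex"
  assumes f: "f \<in> L2" and e: "0 < e"
  obtains n :: nat and g where "0 < n" "g \<in> L2" "\<And>x. cmod (g x) \<le> n" "\<And>x. n < norm x \<Longrightarrow> g x = 0"
    "L2_norm (\<lambda>x. f x - g x) < e"
proof -
  note [measurable] = L2_measurable[OF f]
  define g where "g n x = (if norm x \<le> real n \<and> cmod (f x) \<le> real n then f x else 0)" for n x
  have gm: "g n \<in> borel_measurable borel" for n
    unfolding g_def by measurable
  have "(\<lambda>n. L2_norm (\<lambda>x. f x - g n x)) \<longlonglongrightarrow> 0"
  proof (rule L2_norm_tendsto_0_dominated[OF _ _ L2_integrable[OF f]])
    show "(\<lambda>x. f x - g n x) \<in> borel_measurable borel" for n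
      using gm by measurable
    show "AE x in lborel. (\<lambda>n. f x - g n x) \<longlonglongrightarrow> 0"
    proof (rule AE_I2)
      fix x
      obtain N :: nat where "max (norm x) (cmod (f x)) \<le> N" using real_arch_simple by blast
      then have "f x - g n x = 0" if "N \<le> n" for n
        using that unfolding g_def by auto
      then show "(\<lambda>n. f x - g n x) \<longlonglongrightarrow> 0"
        by (intro tendsto_eventually) (auto simp: eventually_sequentially)
    qed
    show "(cmod (f x - g n x))\<^sup>2 \<le> (cmod (f x))\<^sup>2" for n x
      by (auto simp: g_def)
  qed
  then have "\<forall>\<^sub>F n in sequentially. L2_norm (\<lambda>x. f x - g n x) < e"
    using e by (rule order_tendstoD)
  then have "\<forall>\<^sub>F n in sequentially. L2_norm (\<lambda>x. f x - g n x) < e \<and> 0 < n"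
    using eventually_gt_at_top by (rule eventually_conj)
  then obtain n where n: "L2_norm (\<lambda>x. f x - g n x) < e" "0 < n"
    using eventually_happens by fastforce
  have "integrable lborel (\<lambda>x. (cmod (g n x))\<^sup>2)"
    by (rule Bochner_Integration.integrable_bound[OF L2_integrable[OF f]])
      (use gm in \<open>auto simp: g_def\<close>)
  then have "g n \<in> L2" using gm by (simp add: L2_def)
  then show ?thesis using n by (intro that[of n "g n"]) (auto simp: g_def)
qed

text \<open>Continuous functions converging to \<open>g\<close> almost everywhere exist by
  measurability, but nothing dominates them. Retracting their values to a disc and cutting off at
  infinity supplies a dominating function without changing the limit \<open>g\<close>.\<close>

lemma L2_approx_continuous_bounded:
  fixes g :: "real ^ 'n \<Rightarrow> complex" and n :: nat
  assumes g: "g \<in> L2" "\<And>x. cmod (g x) \<le> n" "\<And>x. n < norm x \<Longrightarrow> g x = 0" and n: "0 < n" and e: "0 < e"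
  obtains \<phi> where "continuous_on UNIV \<phi>" "\<And>x. x \<notin> cball 0 (real n + 1) \<Longrightarrow> \<phi> x = 0"
    "L2_norm (\<lambda>x. g x - \<phi> x) < e"
proof -
  have gm[measurable]: "g \<in> borel_measurable borel" by (rule L2_measurable[OF g(1)])
  then have "g \<in> borel_measurable lebesgue" by (simp add: measurable_completion)
  then have "g measurable_on UNIV" by (intro lebesgue_measurable_imp_measurable_on) auto
  then obtain N h where N: "negligible N" and h: "\<And>k. continuous_on UNIV (h k)"
    and lim: "\<And>x. x \<notin> N \<Longrightarrow> (\<lambda>k. h k x) \<longlonglongrightarrow> g x"
    unfolding measurable_on_def by (auto 4 4)
  \<comment> \<open>\<open>c\<close> is the radial retraction onto the disc of radius
    \<open>n\<close>, and \<open>cut\<close> falls from 1 at radius \<open>n\<close> to 0 at radius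
    \<open>n + 1\<close>; together they fix \<open>g\<close>.\<close>
  define c where "c w = complex_of_real (real n / max (real n) (cmod w)) * w" for w
  define cut where "cut x = max 0 (min 1 (real n + 1 - norm x))" for x :: "real ^ 'n"
  define \<phi> where "\<phi> k x = complex_of_real (cut x) * c (h k x)" for k x
  have c_cont: "continuous_on UNIV c"
    unfolding c_def using n by (intro continuous_intros) auto
  have \<phi>_cont: "continuous_on UNIV (\<phi> k)" for k
    unfolding \<phi>_def cut_def by (intro continuous_intros continuous_on_compose2[OF c_cont] h) auto
  have c_le: "cmod (c w) \<le> n" for w
    using n by (auto simp: c_def norm_mult norm_divide field_simps max_def)
  have c_g: "complex_of_real (cut x) * c (g x) = g x" for x
    using g(2,3)[of x] n by (cases "norm x \<le> n") (auto simp: c_def cut_def max_def)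
  have \<phi>_0: "\<phi> k x = 0" if "x \<notin> cball 0 (real n + 1)" for k x
    using that by (simp add: \<phi>_def cut_def)
  have \<phi>_le: "cmod (\<phi> k x) \<le> n" for k x
    using c_le[of "h k x"] mult_mono[of "\<bar>cut x\<bar>" 1 "cmod (c (h k x))" n]
    by (auto simp: \<phi>_def cut_def norm_mult)
  have "(\<lambda>k. L2_norm (\<lambda>x. g x - \<phi> k x)) \<longlonglongrightarrow> 0"
  proof (rule L2_norm_tendsto_0_dominated)
    show "(\<lambda>x. g x - \<phi> k x) \<in> borel_measurable borel" for k
      using borel_measurable_continuous_onI[OF \<phi>_cont] gm by (intro borel_measurable_diff)
    have "AE x in lborel. x \<notin> N"
      using N AE_not_in[of N lebesgue] by (simp add: AE_completion_iff negligible_iff_null_sets)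
    then show "AE x in lborel. (\<lambda>k. g x - \<phi> k x) \<longlonglongrightarrow> 0"
    proof eventually_elim
      case (elim x)
      have "(\<lambda>k. c (h k x)) \<longlonglongrightarrow> c (g x)"
        using continuous_on_tendsto_compose[OF c_cont lim[OF elim]] by simp
      then have "(\<lambda>k. g x - \<phi> k x) \<longlonglongrightarrow> g x - complex_of_real (cut x) * c (g x)"
        unfolding \<phi>_def by (intro tendsto_intros)
      then show ?case by (simp add: c_g)
    qed
    show "integrable lborel (\<lambda>x :: real ^ 'n. indicator (cball 0 (real n + 1)) x *\<^sub>R (2 * real n)\<^sup>2)"
      by (intro borel_integrable_compact) auto
    show "(cmod (g x - \<phi> k x))\<^sup>2 \<le> indicator (cball 0 (real n + 1)) x *\<^sub>R (2 * real n)\<^sup>2" for k x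
    proof (cases "x \<in> cball 0 (real n + 1)")
      case True
      have "cmod (g x - \<phi> k x) \<le> 2 * real n"
        using norm_triangle_ineq4[of "g x" "\<phi> k x"] g(2)[of x] \<phi>_le[of k x] by linarith
      then have "(cmod (g x - \<phi> k x))\<^sup>2 \<le> (2 * real n)\<^sup>2"
        by (rule power_mono) simp
      then show ?thesis using True by simp
    next
      case False
      then show ?thesis using g(3)[of x] \<phi>_0[of x k] by auto
    qed
  qed
  then have "\<forall>\<^sub>F k in sequentially. L2_norm (\<lambda>x. g x - \<phi> k x) < e"
    using e by (rule order_tendstoD)
  then obtain k where "L2_norm (\<lambda>x. g x - \<phi> k x) < e"
    using eventually_happens by fastforce
  then show ?thesis using \<phi>_cont \<phi>_0 that by blast
qed

lemma L2_approx_continuous: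
  fixes f :: "real ^ 'n \<Rightarrow> complex"
  assumes f: "f \<in> L2" and e: "0 < e"
  obtains \<phi> K where "continuous_on UNIV \<phi>" "compact K" "\<And>x. x \<notin> K \<Longrightarrow> \<phi> x = 0"
    "L2_norm (\<lambda>x. f x - \<phi> x) < e"
proof -
  from e have e2: "0 < e / 2" by simp
  obtain n :: nat and g where n: "0 < n" and g: "g \<in> L2" "\<And>x. cmod (g x) \<le> n" "\<And>x. n < norm x \<Longrightarrow> g x = 0"
    and fg: "L2_norm (\<lambda>x. f x - g x) < e / 2"
    using L2_approx_bounded[OF f e2] by metis
  obtain \<phi> where \<phi>: "continuous_on UNIV \<phi>" "\<And>x. x \<notin> cball 0 (real n + 1) \<Longrightarrow> \<phi> x = 0"
    "L2_norm (\<lambda>x. g x - \<phi> x) < e / 2"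
    using L2_approx_continuous_bounded[OF g n e2] by metis
  have "\<phi> \<in> L2" by (rule continuous_compact_support_L2[OF \<phi>(1) compact_cball \<phi>(2)])
  then have "L2_norm (\<lambda>x. (f x - g x) + (g x - \<phi> x)) < e"
    using L2_norm_triangle[OF L2_diff[OF f g(1)] L2_diff[OF g(1), of \<phi>]] fg \<phi>(3) by simp
  then have "L2_norm (\<lambda>x. f x - \<phi> x) < e" by simp
  from that[OF \<phi>(1) compact_cball \<phi>(2) this] show ?thesis .
qed

lemma distr_invariant:
  fixes T :: "real ^ 'n \<Rightarrow> real ^ 'n"
  assumes T: "distr lborel borel T = lborel" "T \<in> borel_measurable borel"
    and f: "f \<in> borel_measurable borel"
  shows "(LINT x|lborel. f (T x)) = (LINT x|lborel. (f x :: 'b::{banach, second_countable_topology}))"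
    and "integrable lborel (\<lambda>x. f (T x)) \<longleftrightarrow> integrable lborel f"
  using integral_distr[of T lborel borel f] integrable_distr_eq[of T lborel borel f] T f by simp_all

lemma L2_compose_invariant:
  fixes T :: "real ^ 'n \<Rightarrow> real ^ 'n"
  assumes T: "distr lborel borel T = lborel" "T \<in> borel_measurable borel" and f: "f \<in> L2"
  shows "(\<lambda>x. f (T x)) \<in> L2" "L2_norm (\<lambda>x. f (T x)) = L2_norm f"
proof -
  note [measurable] = L2_measurable[OF f] T(2)
  have "(\<lambda>x. (cmod (f x))\<^sup>2) \<in> borel_measurable borel" by measurable
  note * = distr_invariant[OF T this]
  show "(\<lambda>x. f (T x)) \<in> L2" "L2_norm (\<lambda>x. f (T x)) = L2_norm f"
    using * L2_integrable[OF f] by (simp_all add: L2_def L2_norm_def)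
qed

lemma nn_integral_sq_cmod: "f \<in> L2 \<Longrightarrow> (\<integral>\<^sup>+x. ennreal ((cmod (f x))\<^sup>2) \<partial>lborel) = ennreal (sq_norm f)"
  unfolding sq_norm_def by (rule nn_integral_eq_integral) (auto simp: L2_integrable)

section \<open>Continuity of right translations\<close>

context graded_group
begin

lemma compact_thickening:
  assumes "compact K"
  obtains K' where "compact K'" "\<And>x z. gmul x z \<in> K \<Longrightarrow> norm z \<le> 1 \<Longrightarrow> x \<in> K'"
proof (rule that)
  have "continuous_on (K \<times> cball 0 1) (\<lambda>(k, z). gmul k (- z))"
    unfolding split_beta by (intro continuous_gmul continuous_intros)
  then show "compact ((\<lambda>(k, z). gmul k (- z)) ` (K \<times> cball 0 1))"
    by (intro compact_continuous_image compact_Times assms compact_cball)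
  \<comment> \<open>Here x = (x z) z^(-1), with x z in \<open>K\<close> and z in the unit
    ball.\<close>
  show "x \<in> (\<lambda>(k, z). gmul k (- z)) ` (K \<times> cball 0 1)" if "gmul x z \<in> K" "norm z \<le> 1" for x z
    using that by (intro image_eqI[of _ _ "(gmul x z, z)"]) (auto simp: gmul_assoc)
qed

text \<open>Uniform continuity for group translations rather than Euclidean ones. It holds on a
  compact thickening of \<open>K\<close> by compactness, and outside of it both values are below
  \<delta> / 2.\<close>

lemma vanishing_uniformly_continuous_gmul:
  fixes f :: "real ^ 'n \<Rightarrow> 'b::real_normed_vector"
  assumes cont: "continuous_on UNIV f"
    and van: "\<And>\<delta>. 0 < \<delta> \<Longrightarrow> \<exists>K. compact K \<and> (\<forall>x. x \<notin> K \<longrightarrow> norm (f x) < \<delta>)" and "0 < \<delta>"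
  obtains r where "0 < r" "\<And>x z. norm z < r \<Longrightarrow> norm (f (gmul x z) - f x) < \<delta>"
proof -
  obtain K where K: "compact K" "\<And>x. x \<notin> K \<Longrightarrow> norm (f x) < \<delta> / 2"
    using van[of "\<delta> / 2"] \<open>0 < \<delta>\<close> by auto
  obtain K' where K': "compact K'" "\<And>x z. gmul x z \<in> K \<Longrightarrow> norm z \<le> 1 \<Longrightarrow> x \<in> K'"
    using compact_thickening[OF K(1)] by blast
  have "continuous_on (K' \<times> cball 0 1) (\<lambda>p. f (gmul (fst p) (snd p)))"
    by (intro continuous_on_compose2[OF cont] continuous_gmul continuous_intros) auto
  moreover have "compact (K' \<times> (cball 0 1 :: (real ^ 'n) set))" by (intro compact_Times K'(1) compact_cball)
  ultimately have "uniformly_continuous_on (K' \<times> cball 0 1) (\<lambda>p. f (gmul (fst p) (snd p)))"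
    by (rule compact_uniformly_continuous)
  then obtain r where r: "0 < r" and unif: "\<And>p q. p \<in> K' \<times> cball 0 1 \<Longrightarrow> q \<in> K' \<times> cball 0 1 \<Longrightarrow>
      dist q p < r \<Longrightarrow> dist (f (gmul (fst q) (snd q))) (f (gmul (fst p) (snd p))) < \<delta>"
    using \<open>0 < \<delta>\<close> unfolding uniformly_continuous_on_def by meson
  show ?thesis
  proof (rule that[of "min r 1"])
    show "0 < min r 1" using r by simp
    fix x z :: "real ^ 'n" assume z: "norm z < min r 1"
    show "norm (f (gmul x z) - f x) < \<delta>"
    proof (cases "x \<in> K'")
      case True
      then show ?thesis
        using unif[of "(x, 0)" "(x, z)"] z by (simp add: dist_Pair_Pair dist_norm)
    next
      case False
      then have "gmul x z \<notin> K" "x \<notin> K"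
        using K'(2)[of x z] K'(2)[of x 0] z by auto
      then show ?thesis
        using K(2)[of x] K(2)[of "gmul x z"] norm_triangle_ineq4[of "f (gmul x z)" "f x"] by simp
    qed
  qed
qed

lemma L2_right_translation:
  assumes "f \<in> L2" shows "(\<lambda>x. f (gmul x z)) \<in> L2" "L2_norm (\<lambda>x. f (gmul x z)) = L2_norm f"
  by (rule L2_compose_invariant[OF distr_gmul_right _ assms], measurable)+

text \<open>For small \<open>z\<close> the difference lives in one compact set \<open>K'\<close> and
  is uniformly small there, so its L2 norm is at most the sup bound times the square root of the
  measure \<open>m\<close> of \<open>K'\<close>.\<close>

lemma compact_support_translation_L2:
  fixes \<phi> :: "real ^ 'n \<Rightarrow> complex"
  assumes \<phi>: "continuous_on UNIV \<phi>" "compact K" "\<And>x. x \<notin> K \<Longrightarrow> \<phi> x = 0" and e: "0 < e"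
  obtains r where "0 < r" "\<And>z. norm z < r \<Longrightarrow> L2_norm (\<lambda>x. \<phi> (gmul x z) - \<phi> x) < e"
proof -
  obtain K' where K': "compact K'" "\<And>x z. gmul x z \<in> K \<Longrightarrow> norm z \<le> 1 \<Longrightarrow> x \<in> K'"
    using compact_thickening[OF \<phi>(2)] by blast
  have int: "integrable lborel (\<lambda>x. indicator K' x *\<^sub>R (1::real))"
    by (rule borel_integrable_compact[OF K'(1)]) simp
  define m where "m = (LINT x|lborel. indicator K' x *\<^sub>R (1::real))"
  have "0 \<le> m" unfolding m_def by (simp add: integral_nonneg_AE)
  \<comment> \<open>The added 1 avoids division by 0 if \<open>m\<close> is 0, and it makes the
    final inequality strict.\<close>
  define d where "d = e / (sqrt m + 1)"
  have "0 < d" using e \<open>0 \<le> m\<close> by (simp add: d_def add_nonneg_pos)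
  obtain r where r: "0 < r" and small: "\<And>x z. norm z < r \<Longrightarrow> norm (\<phi> (gmul x z) - \<phi> x) < d"
    using vanishing_uniformly_continuous_gmul[OF \<phi>(1) _ \<open>0 < d\<close>] \<phi>(2,3) by (metis norm_zero)
  show ?thesis
  proof (rule that[of "min r 1"])
    show "0 < min r 1" using r by simp
    fix z :: "real ^ 'n" assume z: "norm z < min r 1"
    have 0: "\<phi> (gmul x z) - \<phi> x = 0" if "x \<notin> K'" for x
      using \<phi>(3) K'(2)[of x z] K'(2)[of x 0] z that by (cases "gmul x z \<in> K"; cases "x \<in> K") auto
    have \<phi>L: "\<phi> \<in> L2" by (rule continuous_compact_support_L2[OF \<phi>])
    have "sq_norm (\<lambda>x. \<phi> (gmul x z) - \<phi> x) \<le> (LINT x|lborel. d\<^sup>2 * (indicator K' x *\<^sub>R 1))"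
      unfolding sq_norm_def
    proof (rule integral_mono)
      show "integrable lborel (\<lambda>x. (cmod (\<phi> (gmul x z) - \<phi> x))\<^sup>2)"
        by (intro L2_integrable L2_diff L2_right_translation \<phi>L)
      show "integrable lborel (\<lambda>x. d\<^sup>2 * (indicator K' x *\<^sub>R (1::real)))"
        by (intro integrable_mult_right int)
      show "(cmod (\<phi> (gmul x z) - \<phi> x))\<^sup>2 \<le> d\<^sup>2 * (indicator K' x *\<^sub>R 1)" for x
        using 0[of x] small[of z x] z by (cases "x \<in> K'") (auto intro!: power_mono)
    qed
    also have "\<dots> = d\<^sup>2 * m" unfolding m_def by (rule integral_mult_right_zero)
    finally have "L2_norm (\<lambda>x. \<phi> (gmul x z) - \<phi> x) \<le> sqrt (d\<^sup>2 * m)"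
      unfolding L2_norm_eq_sqrt by (rule real_sqrt_le_mono)
    also have "\<dots> = d * sqrt m" using \<open>0 < d\<close> by (simp add: real_sqrt_mult)
    also have "\<dots> < d * (sqrt m + 1)" using \<open>0 < d\<close> by simp
    also have "\<dots> = e"
    proof -
      have "sqrt m + 1 \<noteq> 0" using real_sqrt_ge_zero[OF \<open>0 \<le> m\<close>] by linarith
      then show ?thesis by (simp add: d_def)
    qed
    finally show "L2_norm (\<lambda>x. \<phi> (gmul x z) - \<phi> x) < e" .
  qed
qed

text \<open>Three-term estimate through a continuous \<phi> with compact support; right invariance
  makes the translated error f - \<phi> as small as the untranslated one.\<close>

lemma L2_translation_continuous:
  assumes f: "f \<in> L2" and e: "0 < e"
  obtains r where "0 < r" "\<And>z. norm z < r \<Longrightarrow> L2_norm (\<lambda>x. f (gmul x z) - f x) < e"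
proof -
  from e have e3: "0 < e / 3" by simp
  obtain \<phi> K where \<phi>: "continuous_on UNIV \<phi>" "compact K" "\<And>x. x \<notin> K \<Longrightarrow> \<phi> x = 0"
    and f\<phi>: "L2_norm (\<lambda>x. f x - \<phi> x) < e / 3"
    using L2_approx_continuous[OF f e3] by blast
  obtain r where r: "0 < r" and small: "\<And>z. norm z < r \<Longrightarrow> L2_norm (\<lambda>x. \<phi> (gmul x z) - \<phi> x) < e / 3"
    using compact_support_translation_L2[OF \<phi> e3] by blast
  have \<phi>L: "\<phi> \<in> L2" by (rule continuous_compact_support_L2[OF \<phi>])
  show ?thesis
  proof (rule that[OF r])
    fix z :: "real ^ 'n" assume z: "norm z < r"
    let ?a = "\<lambda>x. f (gmul x z) - \<phi> (gmul x z)" and ?b = "\<lambda>x. \<phi> (gmul x z) - \<phi> x" and ?c = "\<lambda>x. f x - \<phi> x"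
    have L: "?a \<in> L2" "?b \<in> L2" "?c \<in> L2"
      by (intro L2_diff L2_right_translation f \<phi>L)+
    have "L2_norm (\<lambda>x. f (gmul x z) - f x) = L2_norm (\<lambda>x. (?a x + ?b x) - ?c x)"
      by simp
    also have "\<dots> \<le> L2_norm (\<lambda>x. ?a x + ?b x) + L2_norm ?c"
      by (rule L2_norm_diff_triangle[OF L2_add[OF L(1,2)] L(3)])
    also have "\<dots> \<le> L2_norm ?a + L2_norm ?b + L2_norm ?c"
      using L2_norm_triangle[OF L(1,2)] by simp
    also have "L2_norm ?a = L2_norm ?c"
      by (rule L2_right_translation(2)[OF L(3)])
    finally show "L2_norm (\<lambda>x. f (gmul x z) - f x) < e"
      using f\<phi> small[OF z] by simp
  qed
qed

section \<open>Convolution with a concentrated kernel\<close>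

lemma group_convolution_eq:
  assumes [measurable]: "f \<in> borel_measurable borel" "k \<in> borel_measurable borel"
  shows "group_convolution gmul f k x = (LINT z|lborel. f (gmul x (- z)) * k z)"
proof -
  have "(LINT z|lborel. f (gmul x (- z)) * k (gmul (- gmul x (- z)) x)) = (LINT y|lborel. f y * k (gmul (- y) x))"
    by (rule distr_invariant[OF distr_gmul_minus]) measurable
  moreover have "gmul (- gmul x (- z)) x = z" for z
    by (simp add: minus_gmul gmul_assoc)
  ultimately show ?thesis by (simp add: group_convolution_def)
qed

lemma convolution_minus_eq:
  assumes [measurable]: "f \<in> borel_measurable borel" and k: "integrable lborel k" "(LINT z|lborel. k z) = 1"
    and int: "integrable lborel (\<lambda>z. f (gmul x (- z)) * k z)"
  shows "group_convolution gmul f k x - f x = (LINT z|lborel. (f (gmul x (- z)) - f x) * k z)"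
proof -
  have [measurable]: "k \<in> borel_measurable borel"
    using borel_measurable_integrable[OF k(1)] by simp
  have "(LINT z|lborel. (f (gmul x (- z)) - f x) * k z) =
      (LINT z|lborel. f (gmul x (- z)) * k z) - (LINT z|lborel. f x * k z)"
    unfolding left_diff_distrib using int k(1) by (intro Bochner_Integration.integral_diff) auto
  then show ?thesis by (simp add: group_convolution_eq k(2))
qed

text \<open>As the kernel has integral 1, the error is an average of differences of translates. The
  bound \<open>B\<close> provides integrability; the constant \<open>C\<close> can exceed 1 because
  the kernel is complex.\<close>

lemma convolution_bounded_close:
  fixes f k :: "real ^ 'n \<Rightarrow> complex"
  assumes f[measurable]: "f \<in> borel_measurable borel" and B: "\<And>x. cmod (f x) \<le> B"
    and k: "integrable lborel k" "(LINT z|lborel. k z) = 1" "(LINT z|lborel. cmod (k z)) \<le> C"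
    and supp: "\<And>z. r \<le> norm z \<Longrightarrow> k z = 0"
    and close: "\<And>x z. norm z < r \<Longrightarrow> cmod (f (gmul x z) - f x) \<le> \<delta>" and "0 \<le> \<delta>"
  shows "cmod (group_convolution gmul f k x - f x) \<le> \<delta> * C"
proof -
  have [measurable]: "k \<in> borel_measurable borel"
    using borel_measurable_integrable[OF k(1)] by simp
  have "integrable lborel (\<lambda>z. f (gmul x (- z)) * k z)"
  proof (rule Bochner_Integration.integrable_bound)
    show "integrable lborel (\<lambda>z. complex_of_real B * k z)" using k(1) by simp
    show "AE z in lborel. norm (f (gmul x (- z)) * k z) \<le> norm (complex_of_real B * k z)"
      using B order_trans[OF B abs_ge_self] by (intro AE_I2) (simp add: norm_mult mult_right_mono)
  qed measurable
  note eq = convolution_minus_eq[OF f k(1,2) this]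
  have "cmod (LINT z|lborel. (f (gmul x (- z)) - f x) * k z) \<le> (LINT z|lborel. cmod ((f (gmul x (- z)) - f x) * k z))"
    by (rule integral_norm_bound)
  also have "\<dots> \<le> (LINT z|lborel. \<delta> * cmod (k z))"
  proof (rule integral_mono)
    show "integrable lborel (\<lambda>z. cmod ((f (gmul x (- z)) - f x) * k z))"
      unfolding left_diff_distrib using \<open>integrable lborel (\<lambda>z. f (gmul x (- z)) * k z)\<close> k(1)
      by (intro integrable_norm Bochner_Integration.integrable_diff) auto
    show "integrable lborel (\<lambda>z. \<delta> * cmod (k z))" using k(1) by (intro integrable_mult_right integrable_norm)
    \<comment> \<open>The convolution translates by \<open>- z\<close>, which has the same norm as
      \<open>z\<close>.\<close>
    show "cmod ((f (gmul x (- z)) - f x) * k z) \<le> \<delta> * cmod (k z)" for z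
      using close[of "- z" x] supp[of z] by (cases "norm z < r") (auto simp: norm_mult intro!: mult_right_mono)
  qed
  also have "\<dots> \<le> \<delta> * C" using k(3) \<open>0 \<le> \<delta>\<close> by (simp add: mult_left_mono)
  finally show ?thesis unfolding eq .
qed

text \<open>Minkowski's integral inequality in the form of Cauchy-Schwarz with weight |k| followed
  by Tonelli. The nonnegative integral gives a bound before the convolution is known to be
  measurable or square integrable; a Bochner integral could be 0 by default.\<close>

lemma convolution_L2_close:
  fixes f k :: "real ^ 'n \<Rightarrow> complex"
  assumes f: "f \<in> L2" and kL: "k \<in> L2"
    and k: "integrable lborel k" "(LINT z|lborel. k z) = 1" "(LINT z|lborel. cmod (k z)) \<le> C"
    and supp: "\<And>z. r \<le> norm z \<Longrightarrow> k z = 0"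
    and close: "\<And>z. norm z < r \<Longrightarrow> L2_norm (\<lambda>x. f (gmul x z) - f x) \<le> \<delta>" and "0 \<le> \<delta>"
  shows "(\<integral>\<^sup>+x. ennreal ((cmod (group_convolution gmul f k x - f x))\<^sup>2) \<partial>lborel) \<le> ennreal ((C * \<delta>)\<^sup>2)"
proof -
  have fm[measurable]: "f \<in> borel_measurable borel" by (rule L2_measurable[OF f])
  have [measurable]: "k \<in> borel_measurable borel" by (rule L2_measurable[OF kL])
  define h where "h x z = f (gmul x (- z)) - f x" for x z
  have [measurable]: "(\<lambda>p. h (fst p) (snd p)) \<in> borel_measurable (borel \<Otimes>\<^sub>M borel)"
    unfolding h_def by measurable
  have [measurable]: "(\<lambda>z. h x z) \<in> borel_measurable borel" "(\<lambda>x. h x z) \<in> borel_measurable borel" for x z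
    unfolding h_def by measurable
  have kC: "(\<integral>\<^sup>+z. ennreal (cmod (k z)) \<partial>lborel) \<le> ennreal C"
    using k(3) nn_integral_eq_integral[OF integrable_norm[OF k(1)]] by (simp add: ennreal_leI)
  have "0 \<le> C" using k(3) by (rule order_trans[rotated]) simp
  have pointwise: "ennreal ((cmod (group_convolution gmul f k x - f x))\<^sup>2) \<le>
      (\<integral>\<^sup>+z. ennreal ((cmod (h x z))\<^sup>2 * cmod (k z)) \<partial>lborel) * ennreal C" for x
  proof -
    \<comment> \<open>Both factors are square integrable in \<open>z\<close>, so the convolution
      integral converges at every \<open>x\<close>, not only almost everywhere.\<close>
    have fx: "(\<lambda>z. f (gmul x (- z))) \<in> L2"
      by (rule L2_compose_invariant[OF distr_gmul_minus _ f]) measurable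
    have "(\<lambda>z. cnj (k z)) \<in> L2" using L2_integrable[OF kL] by (simp add: L2_def)
    from L2_mult_cnj_integrable[OF fx this] have int: "integrable lborel (\<lambda>z. f (gmul x (- z)) * k z)" by simp
    have hk: "integrable lborel (\<lambda>z. h x z * k z)"
      unfolding h_def left_diff_distrib using int k(1) by (intro Bochner_Integration.integrable_diff) auto
    have "cmod (group_convolution gmul f k x - f x) \<le> (LINT z|lborel. cmod (h x z * k z))"
      unfolding convolution_minus_eq[OF fm k(1,2) int] h_def by (rule integral_norm_bound)
    then have "ennreal (cmod (group_convolution gmul f k x - f x)) \<le> (\<integral>\<^sup>+z. ennreal (cmod (h x z * k z)) \<partial>lborel)"
      using nn_integral_eq_integral[OF integrable_norm[OF hk]] by (simp add: ennreal_leI)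
    then have "(ennreal (cmod (group_convolution gmul f k x - f x)))\<^sup>2 \<le> (\<integral>\<^sup>+z. ennreal (cmod (h x z * k z)) \<partial>lborel)\<^sup>2"
      by (rule power_mono) simp
    \<comment> \<open>Splitting |k| into two square roots lets Cauchy-Schwarz leave the mass of |k|
      as one factor.\<close>
    also have "(\<integral>\<^sup>+z. ennreal (cmod (h x z * k z)) \<partial>lborel) =
        (\<integral>\<^sup>+z. ennreal (cmod (h x z) * sqrt (cmod (k z))) * ennreal (sqrt (cmod (k z))) \<partial>lborel)"
      by (simp add: norm_mult mult.assoc flip: ennreal_mult)
    also have "\<dots>\<^sup>2 \<le> (\<integral>\<^sup>+z. (ennreal (cmod (h x z) * sqrt (cmod (k z))))\<^sup>2 \<partial>lborel) * (\<integral>\<^sup>+z. (ennreal (sqrt (cmod (k z))))\<^sup>2 \<partial>lborel)"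
      by (rule Cauchy_Schwarz_nn_integral) measurable
    also have "\<dots> = (\<integral>\<^sup>+z. ennreal ((cmod (h x z))\<^sup>2 * cmod (k z)) \<partial>lborel) * (\<integral>\<^sup>+z. ennreal (cmod (k z)) \<partial>lborel)"
      by (simp add: ennreal_power power_mult_distrib)
    also have "\<dots> \<le> (\<integral>\<^sup>+z. ennreal ((cmod (h x z))\<^sup>2 * cmod (k z)) \<partial>lborel) * ennreal C"
      by (intro mult_left_mono kC) simp
    finally show ?thesis by (simp add: ennreal_power)
  qed
  have inner: "(\<integral>\<^sup>+x. ennreal ((cmod (h x z))\<^sup>2 * cmod (k z)) \<partial>lborel) \<le> ennreal (\<delta>\<^sup>2) * ennreal (cmod (k z))" for z
  proof (cases "norm z < r")
    case True
    have "(\<lambda>x. h x z) \<in> L2" unfolding h_def by (intro L2_diff L2_right_translation f)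
    then have "(\<integral>\<^sup>+x. ennreal ((cmod (h x z))\<^sup>2) \<partial>lborel) = ennreal (sq_norm (\<lambda>x. h x z))"
      by (rule nn_integral_sq_cmod)
    also have "\<dots> \<le> ennreal (\<delta>\<^sup>2)"
      using close[of "- z"] True unfolding sq_norm_eq h_def by (intro ennreal_leI power_mono) auto
    finally have "(\<integral>\<^sup>+x. ennreal ((cmod (h x z))\<^sup>2) \<partial>lborel) * ennreal (cmod (k z)) \<le> ennreal (\<delta>\<^sup>2) * ennreal (cmod (k z))"
      by (rule mult_right_mono) simp
    then show ?thesis by (simp add: ennreal_mult nn_integral_multc)
  next
    case False
    then show ?thesis using supp[of z] by simp
  qed
  have "(\<integral>\<^sup>+x. ennreal ((cmod (group_convolution gmul f k x - f x))\<^sup>2) \<partial>lborel) \<le>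
      (\<integral>\<^sup>+x. (\<integral>\<^sup>+z. ennreal ((cmod (h x z))\<^sup>2 * cmod (k z)) \<partial>lborel) * ennreal C \<partial>lborel)"
    by (rule nn_integral_mono) (rule pointwise)
  also have "\<dots> = (\<integral>\<^sup>+x. (\<integral>\<^sup>+z. ennreal ((cmod (h x z))\<^sup>2 * cmod (k z)) \<partial>lborel) \<partial>lborel) * ennreal C"
    by (rule nn_integral_multc) measurable
  also have "(\<integral>\<^sup>+x. (\<integral>\<^sup>+z. ennreal ((cmod (h x z))\<^sup>2 * cmod (k z)) \<partial>lborel) \<partial>lborel) =
      (\<integral>\<^sup>+z. (\<integral>\<^sup>+x. ennreal ((cmod (h x z))\<^sup>2 * cmod (k z)) \<partial>lborel) \<partial>lborel)"
  proof (rule lborel_pair.Fubini')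
    have [measurable]: "fst \<in> borel_measurable (lborel \<Otimes>\<^sub>M lborel)" "snd \<in> borel_measurable (lborel \<Otimes>\<^sub>M lborel)"
      using measurable_fst[of lborel lborel] measurable_snd[of lborel lborel] by simp_all
    have "(\<lambda>p. h (snd p) (fst p)) \<in> borel_measurable (lborel \<Otimes>\<^sub>M lborel)"
      unfolding h_def by measurable
    moreover have "(\<lambda>p. k (fst p)) \<in> borel_measurable (lborel \<Otimes>\<^sub>M lborel)"
      by measurable
    ultimately show "(\<lambda>(z, x). ennreal ((cmod (h x z))\<^sup>2 * cmod (k z))) \<in> borel_measurable (lborel \<Otimes>\<^sub>M lborel)"
      unfolding split_beta by measurable
  qed
  also have "\<dots> \<le> (\<integral>\<^sup>+z. ennreal (\<delta>\<^sup>2) * ennreal (cmod (k z)) \<partial>lborel)"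
    by (rule nn_integral_mono) (rule inner)
  also have "\<dots> = ennreal (\<delta>\<^sup>2) * (\<integral>\<^sup>+z. ennreal (cmod (k z)) \<partial>lborel)"
    by (rule nn_integral_cmult) measurable
  also have "\<dots> \<le> ennreal (\<delta>\<^sup>2) * ennreal C"
    by (intro mult_left_mono kC) simp
  also have "ennreal (\<delta>\<^sup>2) * ennreal C * ennreal C = ennreal ((C * \<delta>)\<^sup>2)"
    using \<open>0 \<le> C\<close> by (simp add: power2_eq_square algebra_simps flip: ennreal_mult)
  finally show ?thesis by (simp add: mult_right_mono)
qed

end

section \<open>Dilations and rescaled mollifiers\<close>

lemma dilation_scale:
  assumes "r \<noteq> 0" shows "dilation \<nu> r (dilation \<nu> (inverse r) x) = x"
  using assms by (simp add: dilation_def vec_eq_iff power_mult_distrib[symmetric] mult.assoc[symmetric])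

lemma continuous_dilation [continuous_intros]: "continuous_on S (dilation \<nu> r)"
  unfolding dilation_def[abs_def] by (intro continuous_intros)

text \<open>All weights are at least 1, so a contracting dilation shrinks at least as much as
  scaling by \<open>r\<close>. The Euclidean norm can therefore measure the supports of rescaled
  mollifiers.\<close>

lemma norm_dilation_le:
  assumes "\<And>i. 1 \<le> \<nu> i" "0 \<le> r" "r \<le> 1" shows "norm (dilation \<nu> r x) \<le> r * norm x"
proof -
  have "norm (dilation \<nu> r x) \<le> norm (r *\<^sub>R x)"
  proof (rule norm_le_componentwise_cart)
    fix i
    have "r ^ \<nu> i \<le> r ^ 1" using assms by (intro power_decreasing) auto
    then show "norm (dilation \<nu> r x $ i) \<le> norm ((r *\<^sub>R x) $ i)"
      using assms by (simp add: dilation_def abs_mult mult_right_mono)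
  qed
  then show ?thesis using assms by simp
qed

lemma lborel_dilation:
  assumes "0 < r"
  shows "lborel = density (distr lborel borel (dilation \<nu> r)) (\<lambda>_. ennreal (r ^ homogeneous_dim \<nu>))"
proof -
  \<comment> \<open>The affine change of variables takes its factors indexed by basis vectors; this
    functional has the value \<open>r ^ \<nu> i\<close> at the \<open>i\<close>-th one.\<close>
  define c where "c b = (\<Sum>i\<in>UNIV. b $ i * r ^ \<nu> i)" for b :: "real ^ 'a"
  have c_axis: "c (axis i 1) = r ^ \<nu> i" for i
    by (simp add: c_def axis_def if_distrib[of "\<lambda>x. x * _"] cong: if_cong)
  have B: "(Basis :: (real ^ 'a) set) = range (\<lambda>i. axis i 1)" by (auto simp: Basis_vec_def)
  have inj: "inj (\<lambda>i :: 'a. axis i (1::real))" by (simp add: axis_eq_axis inj_def)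
  have "c b \<noteq> 0" if "b \<in> Basis" for b
    using that assms unfolding B by (auto simp: c_axis)
  note * = lborel_affine_euclidean[of c 0, OF this]
  have "0 + (\<Sum>j\<in>Basis. (c j * (x \<bullet> j)) *\<^sub>R j) = dilation \<nu> r x" for x
    unfolding B sum.reindex[OF inj]
    using basis_expansion[of "dilation \<nu> r x"]
    by (simp add: c_axis inner_axis dilation_def scalar_mult_eq_scaleR)
  moreover have "(\<Prod>j\<in>Basis. \<bar>c j\<bar>) = r ^ homogeneous_dim \<nu>"
    unfolding B prod.reindex[OF inj] using assms by (simp add: c_axis homogeneous_dim_def power_sum)
  ultimately show ?thesis using * by (simp add: prod_ennreal)
qed

lemma rescaled_integral:
  fixes f :: "real ^ 'n \<Rightarrow> 'b::{banach, second_countable_topology}"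
  assumes r: "0 < r" and [measurable]: "f \<in> borel_measurable borel"
  shows "(LINT x|lborel. r ^ homogeneous_dim \<nu> *\<^sub>R f (dilation \<nu> r x)) = (LINT x|lborel. f x)"
proof -
  have [measurable]: "dilation \<nu> r \<in> borel_measurable borel"
    by (intro borel_measurable_continuous_onI continuous_dilation)
  have "(LINT x|lborel. f x) = (LINT x|density (distr lborel borel (dilation \<nu> r)) (\<lambda>_. ennreal (r ^ homogeneous_dim \<nu>)). f x)"
    using lborel_dilation[OF r, of \<nu>] by simp
  also have "\<dots> = (LINT x|distr lborel borel (dilation \<nu> r). r ^ homogeneous_dim \<nu> *\<^sub>R f x)"
    using r by (intro integral_density) auto
  also have "\<dots> = (LINT x|lborel. r ^ homogeneous_dim \<nu> *\<^sub>R f (dilation \<nu> r x))"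
    by (rule integral_distr) measurable
  finally show ?thesis ..
qed

lemma test_function_support:
  assumes "\<psi> \<in> test_functions"
  obtains \<rho> where "0 < \<rho>" "\<And>x. \<rho> \<le> norm x \<Longrightarrow> \<psi> x = 0"
proof -
  have "bounded {x. \<psi> x \<noteq> 0}"
    using assms compact_imp_bounded bounded_subset closure_subset unfolding test_functions_def by blast
  then obtain b where "0 < b" "\<And>x. \<psi> x \<noteq> 0 \<Longrightarrow> norm x < b"
    unfolding bounded_pos_less by blast
  then show ?thesis using that[of b] by force
qed

lemma rescaled_mollifier:
  assumes \<psi>: "friedrichs_mollifier \<psi>" and \<nu>: "\<And>i. 1 \<le> \<nu> i" and r: "0 < r" "r \<le> 1"
    and \<rho>: "\<And>x. \<rho> \<le> norm x \<Longrightarrow> \<psi> x = 0"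
  shows "rescaled \<nu> r \<psi> \<in> L2" "integrable lborel (rescaled \<nu> r \<psi>)"
    "(LINT x|lborel. rescaled \<nu> r \<psi> x) = 1"
    "(LINT x|lborel. cmod (rescaled \<nu> r \<psi> x)) = (LINT x|lborel. cmod (\<psi> x))"
    "\<And>x. r * \<rho> \<le> norm x \<Longrightarrow> rescaled \<nu> r \<psi> x = 0"
proof -
  have cont: "continuous_on UNIV \<psi>"
    using \<psi> by (simp add: friedrichs_mollifier_def test_functions_def smooth_continuous)
  note [measurable] = borel_measurable_continuous_onI[OF cont]
  have cont': "continuous_on UNIV (rescaled \<nu> r \<psi>)"
    unfolding rescaled_def[abs_def]
    by (intro continuous_intros continuous_on_compose2[OF cont]) auto
  show 0: "rescaled \<nu> r \<psi> x = 0" if "r * \<rho> \<le> norm x" for x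
  proof -
    \<comment> \<open>The contraction estimate is applied to the expanded point, whose dilation by
      \<open>r\<close> is \<open>x\<close>.\<close>
    have "norm x \<le> r * norm (dilation \<nu> (inverse r) x)"
      using norm_dilation_le[where \<nu> = \<nu> and r = r and x = "dilation \<nu> (inverse r) x", OF \<nu>] r by (simp add: dilation_scale)
    then have "r * \<rho> \<le> r * norm (dilation \<nu> (inverse r) x)" using that by simp
    then have "\<rho> \<le> norm (dilation \<nu> (inverse r) x)" using r by simp
    then show ?thesis by (simp add: rescaled_def \<rho>)
  qed
  then have 1: "rescaled \<nu> r \<psi> x = 0" if "x \<notin> cball 0 (r * \<rho>)" for x
    using that by simp
  show "rescaled \<nu> r \<psi> \<in> L2"
    by (rule continuous_compact_support_L2[OF cont' compact_cball 1])
  have "integrable lborel (\<lambda>x. indicator (cball 0 (r * \<rho>)) x *\<^sub>R rescaled \<nu> r \<psi> x)"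
    by (rule borel_integrable_compact[OF compact_cball continuous_on_subset[OF cont']]) simp
  moreover have "indicator (cball 0 (r * \<rho>)) x *\<^sub>R rescaled \<nu> r \<psi> x = rescaled \<nu> r \<psi> x" for x
    using 1[of x] by (auto simp: indicator_def)
  ultimately show "integrable lborel (rescaled \<nu> r \<psi>)" by (simp only:)
  have r': "0 < inverse r" using r by simp
  have "(LINT x|lborel. rescaled \<nu> r \<psi> x) = (LINT x|lborel. \<psi> x)"
    using rescaled_integral[OF r', of \<psi> \<nu>] by (simp add: rescaled_def scaleR_conv_of_real)
  then show "(LINT x|lborel. rescaled \<nu> r \<psi> x) = 1"
    using \<psi> by (simp add: friedrichs_mollifier_def)
  show "(LINT x|lborel. cmod (rescaled \<nu> r \<psi> x)) = (LINT x|lborel. cmod (\<psi> x))"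
    using rescaled_integral[OF r', of "\<lambda>x. cmod (\<psi> x)" \<nu>] r'
    by (simp add: rescaled_def norm_mult norm_power norm_inverse abs_of_pos[OF r(1)])
qed

text \<open>Isolates an approximate identity from the mollifier and the arbitrary scale
  \<open>\<omega>\<close>: in the limits \<open>C\<close> stays fixed while \<open>s\<close> is
  chosen small.\<close>

definition unit_kernel :: "real \<Rightarrow> real \<Rightarrow> (real ^ 'n \<Rightarrow> complex) \<Rightarrow> bool" where
  "unit_kernel C s k \<longleftrightarrow> k \<in> L2 \<and> integrable lborel k \<and> (LINT z|lborel. k z) = 1 \<and>
     (LINT z|lborel. cmod (k z)) \<le> C \<and> (\<forall>z. s \<le> norm z \<longrightarrow> k z = 0)"

section \<open>Limits of regularisations\<close>

context graded_group
begin

text \<open>One \<open>C\<close> serves every scale because the rescaling preserves the L1 norm of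
  the mollifier: the homogeneous dimension is the exponent of the Jacobian of the dilation.\<close>

lemma regularisation_kernel:
  assumes "regularisation gmul \<nu> v v\<epsilon>"
  obtains C where "\<And>s. 0 < s \<Longrightarrow> \<forall>\<^sub>F \<epsilon> in at_right 0. \<exists>k. v\<epsilon> \<epsilon> = group_convolution gmul v k \<and> unit_kernel C s k"
proof -
  obtain \<psi> \<omega> where \<psi>: "friedrichs_mollifier \<psi>" and \<omega>: "\<And>\<epsilon>. \<epsilon> \<in> {0<..1} \<Longrightarrow> 0 < \<omega> \<epsilon>" "(\<omega> \<longlongrightarrow> 0) (at_right 0)"
    and v: "\<And>\<epsilon>. \<epsilon> \<in> {0<..1} \<Longrightarrow> v\<epsilon> \<epsilon> = group_convolution gmul v (rescaled \<nu> (\<omega> \<epsilon>) \<psi>)"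
    using assms unfolding regularisation_def by blast
  obtain \<rho> where \<rho>: "0 < \<rho>" "\<And>x. \<rho> \<le> norm x \<Longrightarrow> \<psi> x = 0"
    using test_function_support \<psi> unfolding friedrichs_mollifier_def by blast
  show ?thesis
  proof (rule that[of "LINT x|lborel. cmod (\<psi> x)"])
    fix s :: real assume "0 < s"
    have "\<forall>\<^sub>F \<epsilon> in at_right 0. \<epsilon> \<in> {0<..<1::real}"
      by (rule eventually_at_right_real) simp
    \<comment> \<open>The bound 1 makes the dilation by \<open>\<omega> \<epsilon>\<close> a
      contraction, and \<open>s / \<rho>\<close> puts the support of the rescaled mollifier inside
      radius \<open>s\<close>.\<close>
    moreover have "\<forall>\<^sub>F \<epsilon> in at_right 0. \<omega> \<epsilon> < min 1 (s / \<rho>)"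
      using \<omega>(2) \<open>0 < s\<close> \<rho>(1) by (intro order_tendstoD(2)) auto
    ultimately show "\<forall>\<^sub>F \<epsilon> in at_right 0. \<exists>k. v\<epsilon> \<epsilon> = group_convolution gmul v k \<and>
        unit_kernel (LINT x|lborel. cmod (\<psi> x)) s k"
    proof eventually_elim
      case (elim \<epsilon>)
      then have r: "0 < \<omega> \<epsilon>" "\<omega> \<epsilon> \<le> 1" and "\<omega> \<epsilon> * \<rho> \<le> s"
        using \<omega>(1)[of \<epsilon>] \<rho>(1) by (auto simp: field_simps)
      then have "rescaled \<nu> (\<omega> \<epsilon>) \<psi> z = 0" if "s \<le> norm z" for z
        using rescaled_mollifier(5)[OF \<psi> weight_pos r \<rho>(2)] that by auto
      then show ?case
        using rescaled_mollifier(1-4)[OF \<psi> weight_pos r \<rho>(2)] v[of \<epsilon>] elim(1)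
        by (intro exI[of _ "rescaled \<nu> (\<omega> \<epsilon>) \<psi>"]) (auto simp: unit_kernel_def)
    qed
  qed
qed

lemma regularisation_uniform_limit:
  assumes reg: "regularisation gmul \<nu> (\<lambda>x. complex_of_real (V x)) V\<epsilon>"
    and V: "vanishing_at_infinity V" and B: "\<And>x. \<bar>V x\<bar> \<le> B" and "0 < \<delta>"
  shows "\<forall>\<^sub>F \<epsilon> in at_right 0. \<forall>x. cmod (V\<epsilon> \<epsilon> x - complex_of_real (V x)) \<le> \<delta>"
proof -
  let ?V = "\<lambda>x. complex_of_real (V x)"
  obtain C where C: "\<And>s. 0 < s \<Longrightarrow> \<forall>\<^sub>F \<epsilon> in at_right 0. \<exists>k. V\<epsilon> \<epsilon> = group_convolution gmul ?V k \<and> unit_kernel C s k"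
    by (rule regularisation_kernel[OF reg]) blast
  \<comment> \<open>The denominator \<open>\<bar>C\<bar> + 1\<close> is positive without any
    information on the sign of \<open>C\<close>, and it dominates \<open>C\<close>.\<close>
  define d where "d = \<delta> / (\<bar>C\<bar> + 1)"
  have "0 < d" using \<open>0 < \<delta>\<close> by (simp add: d_def)
  have cont: "continuous_on UNIV ?V"
    using V by (intro continuous_intros) (simp add: vanishing_at_infinity_def)
  obtain s where s: "0 < s" "\<And>x z. norm z < s \<Longrightarrow> cmod (?V (gmul x z) - ?V x) < d"
    using vanishing_uniformly_continuous_gmul[OF cont _ \<open>0 < d\<close>] V by (auto simp: vanishing_at_infinity_def)
  from C[OF s(1)] show ?thesis
  proof eventually_elim
    case (elim \<epsilon>)
    then obtain k where k: "V\<epsilon> \<epsilon> = group_convolution gmul ?V k" "integrable lborel k" "(LINT z|lborel. k z) = 1"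
      "(LINT z|lborel. cmod (k z)) \<le> C" "\<And>z. s \<le> norm z \<Longrightarrow> k z = 0" unfolding unit_kernel_def by blast
    have "cmod (V\<epsilon> \<epsilon> x - ?V x) \<le> \<delta>" for x
    proof -
      have "cmod (V\<epsilon> \<epsilon> x - ?V x) \<le> d * C"
        unfolding k(1)
        by (rule convolution_bounded_close[OF borel_measurable_continuous_onI[OF cont] _ k(2-5)])
          (use B s(2) \<open>0 < d\<close> in \<open>auto intro: less_imp_le\<close>)
      also have "\<dots> \<le> d * (\<bar>C\<bar> + 1)" using \<open>0 < d\<close> by (intro mult_left_mono) auto
      also have "\<dots> = \<delta>" by (simp add: d_def)
      finally show ?thesis .
    qed
    then show ?case by blast
  qed
qed

text \<open>The nonnegative integral is kept because nothing has placed the regularised function in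
  L2 so far.\<close>

lemma regularisation_L2_limit:
  assumes reg: "regularisation gmul \<nu> f f\<epsilon>" and f: "f \<in> L2" and "0 < \<delta>"
  shows "\<forall>\<^sub>F \<epsilon> in at_right 0. (\<integral>\<^sup>+x. ennreal ((cmod (f\<epsilon> \<epsilon> x - f x))\<^sup>2) \<partial>lborel) \<le> ennreal (\<delta>\<^sup>2)"
proof -
  obtain C where C: "\<And>s. 0 < s \<Longrightarrow> \<forall>\<^sub>F \<epsilon> in at_right 0. \<exists>k. f\<epsilon> \<epsilon> = group_convolution gmul f k \<and> unit_kernel C s k"
    by (rule regularisation_kernel[OF reg]) blast
  define d where "d = \<delta> / (\<bar>C\<bar> + 1)"
  have "0 < d" using \<open>0 < \<delta>\<close> by (simp add: d_def)
  obtain s where s: "0 < s" "\<And>z. norm z < s \<Longrightarrow> L2_norm (\<lambda>x. f (gmul x z) - f x) < d"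
    using L2_translation_continuous[OF f \<open>0 < d\<close>] by blast
  from C[OF s(1)] show ?thesis
  proof eventually_elim
    case (elim \<epsilon>)
    then obtain k where k: "f\<epsilon> \<epsilon> = group_convolution gmul f k" "k \<in> L2" "integrable lborel k" "(LINT z|lborel. k z) = 1"
      "(LINT z|lborel. cmod (k z)) \<le> C" "\<And>z. s \<le> norm z \<Longrightarrow> k z = 0" unfolding unit_kernel_def by blast
    have "0 \<le> C" using k(5) by (rule order_trans[rotated]) simp
    have "(\<integral>\<^sup>+x. ennreal ((cmod (f\<epsilon> \<epsilon> x - f x))\<^sup>2) \<partial>lborel) \<le> ennreal ((C * d)\<^sup>2)"
      unfolding k(1)
      by (rule convolution_L2_close[OF f k(2-6)]) (use s(2) \<open>0 < d\<close> in \<open>auto intro: less_imp_le\<close>)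
    also have "C * d \<le> \<delta>"
    proof -
      have "C * d \<le> (\<bar>C\<bar> + 1) * d" using \<open>0 < d\<close> by (intro mult_right_mono) auto
      also have "\<dots> = \<delta>" by (simp add: d_def)
      finally show ?thesis .
    qed
    then have "ennreal ((C * d)\<^sup>2) \<le> ennreal (\<delta>\<^sup>2)"
      using \<open>0 \<le> C\<close> \<open>0 < d\<close> by (intro ennreal_leI power_mono) auto
    finally show ?case .
  qed
qed

end

lemma vanishing_at_infinity_bounded:
  assumes "vanishing_at_infinity V" obtains B where "\<And>x. \<bar>V x\<bar> \<le> B"
proof -
  obtain K where K: "compact K" "\<And>x. x \<notin> K \<Longrightarrow> \<bar>V x\<bar> < 1"
    using assms unfolding vanishing_at_infinity_def by (meson zero_less_one)
  have "compact (V ` K)"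
    using assms K(1) by (intro compact_continuous_image) (auto simp: vanishing_at_infinity_def intro: continuous_on_subset)
  then obtain b where b: "\<And>x. x \<in> K \<Longrightarrow> \<bar>V x\<bar> \<le> b"
    using compact_imp_bounded bounded_iff by (metis imageI real_norm_def)
  have "\<bar>V x\<bar> \<le> max b 1" for x
    using b[of x] K(2)[of x] by (cases "x \<in> K") auto
  then show ?thesis by (rule that)
qed

text \<open>Passes the estimate for the initial data on to the solutions at time 0: these are in L2
  by definition and agree with the data almost everywhere.\<close>

lemma sq_norm_le_nn_integral:
  assumes "f \<in> L2" "AE x in lborel. f x = g x"
    and "(\<integral>\<^sup>+x. ennreal ((cmod (g x))\<^sup>2) \<partial>lborel) \<le> ennreal c" "0 \<le> c"
  shows "sq_norm f \<le> c"
proof -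
  have "ennreal (sq_norm f) = (\<integral>\<^sup>+x. ennreal ((cmod (g x))\<^sup>2) \<partial>lborel)"
    unfolding nn_integral_sq_cmod[OF assms(1), symmetric] using assms(2) by (intro nn_integral_cong_AE) auto
  then have "ennreal (sq_norm f) \<le> ennreal c" using assms(3) by (simp only:)
  then show ?thesis using assms(4) by simp
qed

lemma sq_norm_zero_AE:
  assumes "f \<in> L2" "sq_norm f = 0" shows "AE x in lborel. f x = 0"
  using integral_nonneg_eq_0_iff_AE[OF L2_integrable[OF assms(1)]] assms(2) by (simp add: sq_norm_def)

section \<open>Convergence of the regularised solutions\<close>

theorem theorem5p4:
  fixes gmul :: "real ^ 'n \<Rightarrow> real ^ 'n \<Rightarrow> real ^ 'n"
    and \<nu> :: "'n \<Rightarrow> nat"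
    and R :: "(real ^ 'n \<Rightarrow> complex) \<Rightarrow> real ^ 'n \<Rightarrow> complex"
    and A :: "((real ^ 'n \<Rightarrow> complex) \<times> (real ^ 'n \<Rightarrow> complex)) set"
    and T :: real
    and V :: "real ^ 'n \<Rightarrow> real"
    and V\<epsilon> :: "real \<Rightarrow> real ^ 'n \<Rightarrow> complex"
    and u0 :: "real ^ 'n \<Rightarrow> complex"
    and u0\<epsilon> :: "real \<Rightarrow> real ^ 'n \<Rightarrow> complex"
    and u\<epsilon> :: "real \<Rightarrow> real \<Rightarrow> real ^ 'n \<Rightarrow> complex"
    and u :: "real \<Rightarrow> real ^ 'n \<Rightarrow> complex"
  assumes "graded_lie_group gmul \<nu>"
    and "rockland_operator gmul \<nu> R" and "positive_operator R"
    and "self_adjoint_extension R A"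
    and "T > 0"
    and "vanishing_at_infinity V"
    and "regularisation gmul \<nu> (\<lambda>x. complex_of_real (V x)) V\<epsilon>"
    and "u0 \<in> L2"
    and "regularisation gmul \<nu> u0 u0\<epsilon>"
    and "\<And>\<epsilon>. \<epsilon> \<in> {0<..1} \<Longrightarrow> heat_solution A (V\<epsilon> \<epsilon>) T (u0\<epsilon> \<epsilon>) (u\<epsilon> \<epsilon>)"
    and "heat_solution A (\<lambda>x. complex_of_real (V x)) T u0 u"
  shows "(\<forall>t\<in>{0..T}. ((\<lambda>\<epsilon>. L2_norm (\<lambda>x. u\<epsilon> \<epsilon> t x - u t x)) \<longlongrightarrow> 0) (at_right 0)) \<and>
    (\<forall>v. heat_solution A (\<lambda>x. complex_of_real (V x)) T u0 v \<longrightarrow>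
       (\<forall>t\<in>{0..T}. AE x in lborel. v t x = u t x))"
proof (intro conjI ballI allI impI)
  interpret graded_group gmul \<nu> by unfold_locales (rule assms(1))
  have R: "differential_operator R" using assms(2) by (simp add: rockland_operator_def)
  note A_diff = self_adjoint_extension_diff[OF assms(4)]
  note A_nonneg = self_adjoint_extension_nonneg[OF assms(4) R assms(3)]
  let ?V = "\<lambda>x. complex_of_real (V x)"
  obtain B where B: "\<And>x. \<bar>V x\<bar> \<le> B" using vanishing_at_infinity_bounded[OF assms(6)] by blast
  have L: "w t \<in> L2" if "heat_solution A W T a w" "t \<in> {0..T}" for W a w t
    using that by (auto simp: heat_solution_def continuous_L2_def)
  \<comment> \<open>The energy of the classical solution is continuous on a compact interval; its
    bound \<open>K\<close> is fixed before \<epsilon> is.\<close>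
  have "continuous_on {0..T} (\<lambda>t. sq_norm (u t))"
    using assms(11) unfolding sq_norm_eq heat_solution_def by (intro continuous_intros continuous_on_L2_norm) blast
  then have "bounded ((\<lambda>t. sq_norm (u t)) ` {0..T})"
    by (intro compact_imp_bounded compact_continuous_image compact_Icc)
  then obtain K where "\<forall>y\<in>(\<lambda>t. sq_norm (u t)) ` {0..T}. norm y \<le> K"
    unfolding bounded_iff by blast
  then have K: "sq_norm (u t) \<le> K" if "t \<in> {0..T}" for t
    using that by fastforce
  fix t assume t: "t \<in> {0..T}"
  have 0: "0 \<in> {0..T}" using assms(5) by simp
  have "0 \<le> K" using K[OF 0] sq_norm_nonneg order_trans by blast
  {
    \<comment> \<open>The energy bound when both the initial error and the distance of the
      potentials are at most \<delta>; \<open>B + 1\<close> bounds the regularised potential as soon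
      as \<delta> \<le> 1.\<close>
    define G where "G \<delta> = sqrt (exp ((2 * (B + 1) + 1) * t) * (\<delta>\<^sup>2 + \<delta>\<^sup>2 * K * t))" for \<delta>
    have bound: "\<forall>\<^sub>F \<epsilon> in at_right 0. L2_norm (\<lambda>x. u\<epsilon> \<epsilon> t x - u t x) \<le> G \<delta>" if \<delta>: "0 < \<delta>" "\<delta> \<le> 1" for \<delta>
    proof -
      have "\<forall>\<^sub>F \<epsilon> in at_right 0. \<epsilon> \<in> {0<..<1::real}"
        by (rule eventually_at_right_real) simp
      then show ?thesis
        using regularisation_uniform_limit[OF assms(7,6) B \<delta>(1)] regularisation_L2_limit[OF assms(9,8) \<delta>(1)]
      proof eventually_elim
        case (elim \<epsilon>)
        then have "\<epsilon> \<in> {0<..1}" by simp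
        note sol = assms(10)[OF this]
        have V\<epsilon>: "cmod (V\<epsilon> \<epsilon> x) \<le> B + 1" for x
          using elim(2)[rule_format, of x] B[of x] \<delta>(2) norm_triangle_sub[of "V\<epsilon> \<epsilon> x" "?V x"] by simp
        have "AE x in lborel. u\<epsilon> \<epsilon> 0 x = u0\<epsilon> \<epsilon> x" "AE x in lborel. u 0 x = u0 x"
          using sol assms(11) by (auto simp: heat_solution_def)
        then have "AE x in lborel. u\<epsilon> \<epsilon> 0 x - u 0 x = u0\<epsilon> \<epsilon> x - u0 x"
          by eventually_elim simp
        from sq_norm_le_nn_integral[OF L2_diff[OF L[OF sol 0] L[OF assms(11) 0]] this elim(3)]
        have init: "sq_norm (\<lambda>x. u\<epsilon> \<epsilon> 0 x - u 0 x) \<le> \<delta>\<^sup>2" by simp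
        have "sq_norm (\<lambda>x. u\<epsilon> \<epsilon> t x - u t x) \<le>
            exp ((2 * (B + 1) + 1) * t) * (sq_norm (\<lambda>x. u\<epsilon> \<epsilon> 0 x - u 0 x) + \<delta>\<^sup>2 * K * t)"
          by (rule heat_solution_energy[OF A_diff A_nonneg sol assms(11) V\<epsilon> _ K t]) (use elim(2) in auto)
        also have "\<dots> \<le> exp ((2 * (B + 1) + 1) * t) * (\<delta>\<^sup>2 + \<delta>\<^sup>2 * K * t)"
          using init by (intro mult_left_mono) auto
        finally show ?case unfolding L2_norm_eq_sqrt G_def by (rule real_sqrt_le_mono)
      qed
    qed
    have "(G \<longlongrightarrow> sqrt (exp ((2 * (B + 1) + 1) * t) * (0\<^sup>2 + 0\<^sup>2 * K * t))) (at_right 0)"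
      unfolding G_def by (intro tendsto_intros)
    then have G0: "(G \<longlongrightarrow> 0) (at_right 0)" by simp
    show "((\<lambda>\<epsilon>. L2_norm (\<lambda>x. u\<epsilon> \<epsilon> t x - u t x)) \<longlongrightarrow> 0) (at_right 0)"
    proof (rule tendstoI)
      \<comment> \<open>First \<delta> is chosen so that \<open>G \<delta>\<close> is below
        \<open>e\<close>; \<open>bound\<close> then holds for all small \<epsilon> at this fixed
        \<delta>.\<close>
      fix e :: real assume "0 < e"
      have "\<forall>\<^sub>F \<delta> in at_right 0. \<delta> \<in> {0<..<1::real}"
        by (rule eventually_at_right_real) simp
      with order_tendstoD(2)[OF G0 \<open>0 < e\<close>]
      have "\<forall>\<^sub>F \<delta> in at_right 0. G \<delta> < e \<and> \<delta> \<in> {0<..<1::real}"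
        by (rule eventually_conj)
      then have "\<exists>\<delta>. G \<delta> < e \<and> \<delta> \<in> {0<..<1::real}"
        by (rule eventually_happens'[rotated]) simp
      then obtain \<delta> where \<delta>: "0 < \<delta>" "\<delta> \<le> 1" "G \<delta> < e" by auto
      show "\<forall>\<^sub>F \<epsilon> in at_right 0. dist (L2_norm (\<lambda>x. u\<epsilon> \<epsilon> t x - u t x)) 0 < e"
        using bound[OF \<delta>(1,2)] by eventually_elim (use \<delta>(3) in simp)
    qed
  }
  {
    fix v assume v: "heat_solution A ?V T u0 v"
    have "AE x in lborel. v 0 x = u0 x" "AE x in lborel. u 0 x = u0 x"
      using v assms(11) by (auto simp: heat_solution_def)
    then have "AE x in lborel. v 0 x - u 0 x = 0" by eventually_elim simp
    from sq_norm_le_nn_integral[OF L2_diff[OF L[OF v 0] L[OF assms(11) 0]] this, of 0]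
    have init: "sq_norm (\<lambda>x. v 0 x - u 0 x) = 0" by (simp add: order.antisym)
    \<comment> \<open>The potentials coincide, so the energy estimate applies with \<delta> = 0 and
      leaves only the initial difference, which is 0.\<close>
    have "sq_norm (\<lambda>x. v t x - u t x) \<le> exp ((2 * B + 1) * t) * (sq_norm (\<lambda>x. v 0 x - u 0 x) + 0\<^sup>2 * K * t)"
      by (rule heat_solution_energy[OF A_diff A_nonneg v assms(11) _ _ K t]) (use B in auto)
    then have "sq_norm (\<lambda>x. v t x - u t x) = 0"
      using sq_norm_nonneg by (simp add: init order.antisym)
    from sq_norm_zero_AE[OF L2_diff[OF L[OF v t] L[OF assms(11) t]] this]
    show "AE x in lborel. v t x = u t x" by simp
  }
qed

end
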